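(* Suppose Assumptions 1 and 2 (stated in the context) hold, and let $\hat\mu_{\mathrm d}(x)$ be the debiased Mondrian random forest estimator of debiasing order $J\ge0$ with base lifetime $\lambda=\lambda_n$ and $B=B_n$ trees in each forest. With $B_r(x)$ the bias coefficients described in the context and $\bar\omega=\sum_{r=0}^J\omega_ra_r^{-2J-2}$, $$\mathbb{E}\left[\left(\mathbb{E}[\hat\mu_{\mathrm d}(x)\mid\mathbf{X},\mathbf{T}]-\mu(x)-\mathbb{I}\{2J+2<\beta\}\frac{\bar\omega B_{J+1}(x)}{\lambda^{2J+2}}\right)^2\right]\lesssim\frac{1}{\lambda^{2((2J+4)\wedge\beta)}}+\frac{1}{\lambda^{2(1\wedge\beta)}B}+\frac{1}{\lambda^{2(1\wedge\beta)}}\frac{\lambda^d}{n}.$$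
   Context: Notation. $\mathbb{N}=\{0,1,2,\dots\}$; $a\wedge b$ and $a\vee b$ are minimum and maximum. For non-negative sequences, $a_n\lesssim b_n$ (equivalently $b_n\gtrsim a_n$) means $a_n/b_n$ is bounded over $n\ge1$ (the bound may depend on fixed quantities such as $d$, $x$, $J$, $a_r$, the law of the data and the sequences $\lambda_n,B_n$, but not on $n$). $\mathbb{I}$ denotes an indicator. Hölder classes. For $\beta>0$ let $\underline{\beta}=\lceil\beta-1\rceil$ be the largest integer strictly less than $\beta$. Write $g\in\mathcal{H}^\beta$ if $g:[0,1]^d\to\mathbb{R}$ is $\underline\beta$ times differentiable and, for some $C>0$, $\max_{|\nu|=\underline\beta}|\partial^\nu g(x)-\partial^\nu g(x')|\le C\|x-x'\|_2^{\beta-\underline\beta}$ for all $x,x'\in[0,1]^d$ ($\nu\in\mathbb{N}^d$ a multi-index). Assumption 1 (data). Fix $d\ge1$. $(X_i,Y_i)$, $1\le i\le n$, are i.i.d. from a distribution on $\mathbb{R}^d\times\mathbb{R}$; $\mathbf{X}=(X_1,\dots,X_n)$. $X_i$ has a Lebesgue density $f$ on $[0,1]^d$, bounded away from zero, with $f\in\mathcal{H}^{\beta_f}$ for some $\beta_f>0$. $\mathbb{E}[Y_i^2\mid X_i]$ is bounded, $\mu(X_i)=\mathbb{E}[Y_i\mid X_i]$ with $\mu\in\mathcal{H}^{\beta_\mu}$, $\beta_\mu>0$. With $\varepsilon_i=Y_i-\mu(X_i)$, $\sigma^2(X_i)=\mathbb{E}[\varepsilon_i^2\mid X_i]$ is bounded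 away from zero with $\sigma^2\in\mathcal{H}^{\beta_\sigma}$, $\beta_\sigma>0$. Set $\beta=\beta_\mu\wedge(\beta_f+1)$. Mondrian process $\mathcal{M}([0,1]^d,\lambda)$. For a rectangle $D=\prod_j[l_j,u_j]\subseteq[0,1]^d$ let $|D_j|=u_j-l_j$, $|D|=\prod_j|D_j|$, $|D|_1=\sum_j|D_j|$. Start at time $0$ with the trivial partition of $[0,1]^d$. For each cell $D$, formed at time $t_D$, sample $E_D\sim\mathrm{Exp}(|D|_1)$ (rate $|D|_1$) independently. If $t_D+E_D\le\lambda$, split $D$: choose coordinate $K$ with $\mathbb{P}(K=j)=|D_j|/|D|_1$ and location $S\sim\mathrm{Unif}[l_K,u_K]$, producing cells $\{x\in D:x_K\le S\}$ and $\{x\in D:x_K>S\}$, each formed at time $t_D+E_D$. The output $T$ is the partition consisting of the cells not split (those with $t_D+E_D>\lambda$); $T(x)$ is the cell containing $x$. Assumption 2 (estimator). $x\in(0,1)^d$ is a fixed point; $\lambda=\lambda_n>0$ and $B=B_n\ge1$ satisfy $\lambda\gtrsim(\log n)^3$, $n/\lambda^d\to\infty$, and $B\gtrsim(\log n)^d$. The dimension $d$ does not depend on $n$. Bias coefficients. For $1\le r\le\lfloor\underline\beta/2\rfloor$, $B_r(x)\in\mathbb{R}$ are the non-random coefficients, functions of the derivatives of $f$ and $\mu$ at $x$ up to order $2r$ and not depending on $\lambda$, $B$ or $n$, in the bias expansion of the ordinary Mondrian random forest: under Assumptions 1 and 2, with $T_1,\dots,T_B$ i.i.d. $\mathcal{M}([0,1]^d,\lambda)$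 independent of the data and $\hat\mu(x)=\frac1B\sum_b\frac{\sum_iY_i\mathbb{I}\{X_i\in T_b(x)\}}{\sum_i\mathbb{I}\{X_i\in T_b(x)\}}$ ($0/0=0$), one has $\mathbb{E}\big[\big(\mathbb{E}[\hat\mu(x)\mid\mathbf{X},T_1,\dots,T_B]-\mu(x)-\sum_{r=1}^{\lfloor\underline\beta/2\rfloor}B_r(x)\lambda^{-2r}\big)^2\big]\lesssim\lambda^{-2\beta}+\lambda^{-2(1\wedge\beta)}B^{-1}+\lambda^{-2(1\wedge\beta)}\lambda^d/n$ (this is the paper's Lemma 1). Debiased Mondrian random forest. Fix an integer $J\ge0$ and distinct constants $a_0,\dots,a_J>0$ (not depending on $n$). Let $\omega_0,\dots,\omega_J\in\mathbb{R}$ be the unique solution of $\sum_{r=0}^J\omega_r=1$ and $\sum_{r=0}^J\omega_ra_r^{-2s}=0$ for $1\le s\le J$. Let $T_{br}\sim\mathcal{M}([0,1]^d,a_r\lambda)$, $1\le b\le B$, $0\le r\le J$, be mutually independent and independent of the data; $\mathbf{T}$ is the collection of all these trees. With $N_{br}(x)=\sum_{i=1}^n\mathbb{I}\{X_i\in T_{br}(x)\}$ and $0/0=0$, $\hat\mu_{\mathrm d}(x)=\sum_{r=0}^J\omega_r\frac1B\sum_{b=1}^B\frac{\sum_{i=1}^nY_i\,\mathbb{I}\{X_i\in T_{br}(x)\}}{N_{br}(x)}$. *)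

theory Defs
  imports "HOL-Probability.Probability"
begin

section \<open>Asymptotic comparison\<close>

definition lesssim :: "(nat \<Rightarrow> ennreal) \<Rightarrow> (nat \<Rightarrow> ennreal) \<Rightarrow> bool" (infix "\<lesssim>" 50) where
  "a \<lesssim> b \<longleftrightarrow> (\<exists>C::real. \<forall>n\<ge>1. a n \<le> ennreal C * b n)"


section \<open>Hoelder classes on the unit cube\<close>

text \<open>The largest integer strictly below a positive \<open>\<beta>\<close>.\<close>

definition strict_floor :: "real \<Rightarrow> nat" where
  "strict_floor \<beta> = nat \<lceil>\<beta> - 1\<rceil>"

text \<open>
  \<open>D \<nu>\<close> is the partial derivative of \<open>g\<close> of multi-index \<open>\<nu>\<close>. Derivatives are taken within the
  closed cube, hence one-sided on its boundary; they are unique there, because the cube is convex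
  with nonempty interior. Values of \<open>g\<close> outside the cube are irrelevant.
\<close>

definition holder_class :: "real \<Rightarrow> (real^'d::finite \<Rightarrow> real) set" where
  "holder_class \<beta> = {g. \<exists>D :: nat^'d \<Rightarrow> real^'d \<Rightarrow> real.
     (\<forall>x\<in>cbox 0 1. D 0 x = g x) \<and>
     (\<forall>\<nu>. (\<Sum>j\<in>UNIV. \<nu> $ j) < strict_floor \<beta> \<longrightarrow>
        (\<forall>x\<in>cbox 0 1. (D \<nu> has_derivative (\<lambda>h. \<Sum>j\<in>UNIV. h $ j * D (\<nu> + axis j 1) x))
                        (at x within cbox 0 1))) \<and>
     (\<exists>C>0. \<forall>\<nu>. (\<Sum>j\<in>UNIV. \<nu> $ j) = strict_floor \<beta> \<longrightarrow>
        (\<forall>x\<in>cbox 0 1. \<forall>x'\<in>cbox 0 1.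
           \<bar>D \<nu> x - D \<nu> x'\<bar> \<le> C * norm (x - x') powr (\<beta> - strict_floor \<beta>)))}"


section \<open>The data\<close>

text \<open>
  \<open>P\<close> is the law of one pair \<open>(X, Y)\<close>, with \<open>X = fst\<close> and \<open>Y = snd\<close>. The functions \<open>f\<close>, \<open>\<mu>\<close> and
  \<open>\<sigma>2\<close> matter only on the unit cube.
\<close>

definition sigma_X :: "((real^'d) \<times> real) measure \<Rightarrow> ((real^'d::finite) \<times> real) measure" where
  "sigma_X P = vimage_algebra (space P) fst borel"

definition regression_model ::
    "((real^'d::finite) \<times> real) measure \<Rightarrow> (real^'d \<Rightarrow> real) \<Rightarrow> (real^'d \<Rightarrow> real) \<Rightarrow>
     (real^'d \<Rightarrow> real) \<Rightarrow> real \<Rightarrow> real \<Rightarrow> real \<Rightarrow> bool" where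
  "regression_model P f \<mu> \<sigma>2 \<beta>\<^sub>f \<beta>\<^sub>\<mu> \<beta>\<^sub>\<sigma> \<longleftrightarrow>
     prob_space P \<and> sets P = sets borel \<and>
     0 < \<beta>\<^sub>f \<and> 0 < \<beta>\<^sub>\<mu> \<and> 0 < \<beta>\<^sub>\<sigma> \<and>
     distributed P lborel fst (\<lambda>x. ennreal (f x) * indicator (cbox 0 1) x) \<and>
     (\<exists>c>0. \<forall>x\<in>cbox 0 1. c \<le> f x) \<and>
     f \<in> holder_class \<beta>\<^sub>f \<and>
     (\<exists>C::real. AE z in P. nn_cond_exp P (sigma_X P) (\<lambda>z. ennreal ((snd z)\<^sup>2)) z \<le> ennreal C) \<and>
     (AE z in P. real_cond_exp P (sigma_X P) snd z = \<mu> (fst z)) \<and>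
     \<mu> \<in> holder_class \<beta>\<^sub>\<mu> \<and>
     (AE z in P. nn_cond_exp P (sigma_X P) (\<lambda>z. ennreal ((snd z - \<mu> (fst z))\<^sup>2)) z
                   = ennreal (\<sigma>2 (fst z))) \<and>
     (\<exists>c>0. \<forall>x\<in>cbox 0 1. c \<le> \<sigma>2 x) \<and>
     \<sigma>2 \<in> holder_class \<beta>\<^sub>\<sigma>"


section \<open>The Mondrian process\<close>

text \<open>
  A partition is stored as the binary tree of its splits: \<open>Node a (j, s) b\<close> splits a cell at
  location \<open>s\<close> along coordinate \<open>j\<close>, \<open>a\<close> being the part where the coordinate is at most \<open>s\<close>.
\<close>

type_synonym 'd mtree = "('d \<times> real) tree"

fun cells :: "'d mtree \<Rightarrow> (real^'d::finite) set \<Rightarrow> (real^'d) set set" where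
  "cells Leaf D = {D}"
| "cells (Node a (j, s) b) D = cells a {x \<in> D. x $ j \<le> s} \<union> cells b {x \<in> D. s < x $ j}"

definition cell_at :: "'d mtree \<Rightarrow> real^'d \<Rightarrow> (real^'d::finite) set" where
  "cell_at T x = (THE C. C \<in> cells T (cbox 0 1) \<and> x \<in> C)"

text \<open>
  Inverse transform sampling of the split coordinate: with side lengths \<open>h\<close>, a uniform \<open>v\<close> on
  \<open>[0,1]\<close> yields coordinate \<open>j\<close> with probability \<open>h $ j / (\<Sum>i. h $ i)\<close>
  (lemma \<open>measure_split_coord\<close> below). The coordinates are enumerated by \<open>to_nat_on UNIV\<close>.
\<close>

definition split_coord :: "real^'d \<Rightarrow> real \<Rightarrow> 'd::finite" where
  "split_coord h v = (THE j.
     (\<Sum>i | to_nat_on UNIV i < to_nat_on UNIV j. h $ i) \<le> v * (\<Sum>i\<in>UNIV. h $ i) \<and>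
     v * (\<Sum>i\<in>UNIV. h $ i) < (\<Sum>i | to_nat_on UNIV i \<le> to_nat_on UNIV j. h $ i))"

lemma split_coord_eq_iff:
  fixes h :: "real^'d::finite"
  assumes h: "\<And>i. 0 \<le> h $ i"
    and v: "0 \<le> v" "v < 1" and pos: "0 < (\<Sum>i\<in>UNIV. h $ i)"
  shows "split_coord h v = j \<longleftrightarrow>
     (\<Sum>i | to_nat_on UNIV i < to_nat_on UNIV j. h $ i) \<le> v * (\<Sum>i\<in>UNIV. h $ i) \<and>
     v * (\<Sum>i\<in>UNIV. h $ i) < (\<Sum>i | to_nat_on UNIV i \<le> to_nat_on UNIV j. h $ i)"
proof -
  let ?n = "to_nat_on (UNIV :: 'd set)"
  let ?V = "v * (\<Sum>i\<in>UNIV. h $ i)"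
  define P where "P j \<longleftrightarrow> (\<Sum>i | ?n i < ?n j. h $ i) \<le> ?V \<and> ?V < (\<Sum>i | ?n i \<le> ?n j. h $ i)" for j
  have inj: "?n i = ?n j \<longleftrightarrow> i = j" for i j by (simp add: countable_finite)
  have uniq: "i = j" if "P i" "P j" for i j
  proof (rule ccontr)
    assume "i \<noteq> j"
    then consider "?n i < ?n j" | "?n j < ?n i" using inj by (meson linorder_neqE_nat)
    then show False
    proof cases
      case 1
      have "(\<Sum>k | ?n k \<le> ?n i. h $ k) \<le> (\<Sum>k | ?n k < ?n j. h $ k)"
        using 1 h by (intro sum_mono2) auto
      then show False using that by (simp add: P_def)
    next
      case 2
      have "(\<Sum>k | ?n k \<le> ?n j. h $ k) \<le> (\<Sum>k | ?n k < ?n i. h $ k)"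
        using 2 h by (intro sum_mono2) auto
      then show False using that by (simp add: P_def)
    qed
  qed
  have "\<exists>j. P j"
  proof -
    define Q where "Q m \<longleftrightarrow> ?V < (\<Sum>i | ?n i \<le> m. h $ i)" for m
    have bij: "bij_betw ?n UNIV {..<CARD('d)}" by (simp add: to_nat_on_finite)
    have "{i. ?n i \<le> CARD('d) - 1} = UNIV"
    proof -
      have "?n i < CARD('d)" for i using bij by (auto simp: bij_betw_def)
      then have "?n i \<le> CARD('d) - 1" for i by (metis Suc_leI diff_Suc_1 diff_le_mono)
      then show ?thesis by blast
    qed
    then have Q1: "Q (CARD('d) - 1)" using v pos by (simp add: Q_def)
    define m where "m = (LEAST m. Q m)"
    have Qm: "Q m" and le: "m \<le> CARD('d) - 1"
      unfolding m_def using Q1 by (rule LeastI, rule Least_le)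
    have "m < CARD('d)" using le zero_less_card_finite[where 'a = 'd] by linarith
    then have "m \<in> ?n ` UNIV" using bij unfolding bij_betw_def by blast
    then obtain j where j: "?n j = m" by blast
    have "(\<Sum>i | ?n i < m. h $ i) \<le> ?V"
    proof (cases m)
      case 0 then show ?thesis using v pos by simp
    next
      case (Suc m')
      have "\<not> Q m'" using not_less_Least[of m' Q] Suc m_def by simp
      then show ?thesis by (simp add: Q_def Suc less_Suc_eq_le)
    qed
    then show ?thesis using Qm by (auto simp: P_def Q_def j intro!: exI[of _ j])
  qed
  then have "\<exists>!j. P j" using uniq by blast
  then have "(THE j. P j) = j \<longleftrightarrow> P j" by (metis the_equality theI')
  then show ?thesis by (simp add: split_coord_def P_def)
qed

lemma measure_split_coord:
  fixes h :: "real^'d::finite"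
  assumes h: "\<And>i. 0 \<le> h $ i" and pos: "0 < (\<Sum>i\<in>UNIV. h $ i)"
  shows "measure (uniform_measure lborel {0..1}) {v \<in> {0..<1}. split_coord h v = j} = h $ j / (\<Sum>i\<in>UNIV. h $ i)"
proof -
  let ?n = "to_nat_on (UNIV :: 'd set)" and ?s = "\<Sum>i\<in>UNIV. h $ i"
  define A where "A = (\<Sum>i | ?n i < ?n j. h $ i)"
  have "{i. ?n i \<le> ?n j} = insert j {i. ?n i < ?n j}"
    by (auto simp: order_le_less countable_finite)
  then have A2: "(\<Sum>i | ?n i \<le> ?n j. h $ i) = h $ j + A" by (simp add: A_def)
  have le: "h $ j + A \<le> ?s" unfolding A2[symmetric] using h by (intro sum_mono2) auto
  have A0: "0 \<le> A" using h by (auto simp: A_def intro: sum_nonneg)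
  have *: "0 \<le> v \<and> v < 1 \<and> split_coord h v = j \<longleftrightarrow> A \<le> v * ?s \<and> v * ?s < h $ j + A" for v
  proof -
    have "0 \<le> v \<and> v < 1" if "A \<le> v * ?s" "v * ?s < h $ j + A"
    proof -
      have "0 \<le> v * ?s" "v * ?s < 1 * ?s"
        using that \<open>h $ j + A \<le> ?s\<close> A0 by linarith+
      then show ?thesis using pos by (simp only: zero_le_mult_iff mult_less_cancel_right) auto
    qed
    then show ?thesis
      using split_coord_eq_iff[OF h _ _ pos, of v j] by (auto simp: A2 A_def[symmetric])
  qed
  have "{v \<in> {0..<1}. split_coord h v = j} = {A / ?s..<(h $ j + A) / ?s}"
  proof (rule set_eqI)
    fix v
    have "v \<in> {A / ?s..<(h $ j + A) / ?s} \<longleftrightarrow> A \<le> v * ?s \<and> v * ?s < h $ j + A"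
      using pos by (simp add: pos_divide_le_eq pos_less_divide_eq)
    then show "v \<in> {v \<in> {0..<1}. split_coord h v = j} \<longleftrightarrow> v \<in> {A / ?s..<(h $ j + A) / ?s}"
      using *[of v] by simp
  qed
  moreover have "{0..1} \<inter> {A / ?s..<(h $ j + A) / ?s} = {A / ?s..<(h $ j + A) / ?s}"
  proof -
    have "0 \<le> A / ?s" "(h $ j + A) / ?s \<le> 1"
      using A0 le pos by (simp_all add: pos_divide_le_eq)
    then show ?thesis by auto
  qed
  moreover have "A / ?s \<le> (h $ j + A) / ?s" using pos h[of j] by (simp add: divide_right_mono)
  ultimately show ?thesis
    by (simp add: measure_uniform_measure add_divide_distrib)
qed

text \<open>
  Potential cells are addressed by lists of booleans, the cell of address \<open>p\<close> having the children
  \<open>False # p\<close> and \<open>True # p\<close>. Each address \<open>p\<close> carries an independent triple \<open>\<omega> p = (e, v, w)\<close>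
  with \<open>e\<close> standard exponential and \<open>v\<close>, \<open>w\<close> uniform on \<open>[0,1]\<close>. For the cell with lower corner
  \<open>l\<close> and upper corner \<open>u\<close> these give \<open>E = e / (\<Sum>i. u $ i - l $ i)\<close>, exponential with rate the
  sum of the side lengths, \<open>K = split_coord (u - l) v\<close>, and \<open>S\<close> uniform on \<open>[l $ K, u $ K]\<close>.
  The second argument of \<open>grow\<close> bounds the depth; the result is \<open>None\<close> if the process is not
  finished within that depth, and otherwise does not depend on it.
\<close>

type_synonym node_noise = "real \<times> real \<times> real"

fun grow :: "real \<Rightarrow> nat \<Rightarrow> (bool list \<Rightarrow> node_noise) \<Rightarrow> bool list \<Rightarrow> real \<Rightarrow>
    real^'d \<Rightarrow> real^'d \<Rightarrow> ('d::finite) mtree option" where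
  "grow lam 0 \<omega> p t l u = None"
| "grow lam (Suc k) \<omega> p t l u =
     (let (e, v, w) = \<omega> p;
          t' = t + e / (\<Sum>i\<in>UNIV. u $ i - l $ i)
      in if t' > lam then Some Leaf
         else let K = split_coord (u - l) v;
                  S = l $ K + w * (u $ K - l $ K)
              in case (grow lam k \<omega> (False # p) t' l (\<chi> i. if i = K then S else u $ i),
                       grow lam k \<omega> (True # p) t' (\<chi> i. if i = K then S else l $ i) u) of
                   (Some a, Some b) \<Rightarrow> Some (Node a (K, S) b)
                 | _ \<Rightarrow> None)"

text \<open>The value \<open>Leaf\<close> for a process that never finishes concerns only a null event.\<close>

definition mondrian_tree :: "real \<Rightarrow> (bool list \<Rightarrow> node_noise) \<Rightarrow> ('d::finite) mtree" where
  "mondrian_tree lam \<omega> =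
     (let T = (\<lambda>k. grow lam k \<omega> [] 0 (0 :: real^'d) 1)
      in case T (LEAST k. T k \<noteq> None) of Some t \<Rightarrow> t | None \<Rightarrow> Leaf)"

definition mondrian_noise :: "(bool list \<Rightarrow> node_noise) measure" where
  "mondrian_noise = (\<Pi>\<^sub>M p\<in>UNIV. density lborel (exponential_density 1) \<Otimes>\<^sub>M
     (uniform_measure lborel {0..1} \<Otimes>\<^sub>M uniform_measure lborel {0..1}))"

definition mondrian :: "real \<Rightarrow> ('d::finite) mtree measure" where
  "mondrian lam = distr mondrian_noise (tree_sigma (count_space UNIV \<Otimes>\<^sub>M borel)) (mondrian_tree lam)"


lemma borel_measurable_vec_nth [measurable (raw)]:
  fixes l :: "'a \<Rightarrow> real^'d::finite"
  assumes [measurable]: "l \<in> borel_measurable M"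
  shows "(\<lambda>z. l z $ i) \<in> borel_measurable M"
  by (rule measurable_compose[OF assms], rule borel_measurable_continuous_onI)
     (intro continuous_intros)

lemma measurable_split_coord [measurable (raw)]:
  fixes h :: "'a \<Rightarrow> real^'d::finite"
  assumes [measurable]: "h \<in> borel_measurable M" "v \<in> borel_measurable M"
  shows "(\<lambda>z. split_coord (h z) (v z)) \<in> M \<rightarrow>\<^sub>M count_space UNIV"
proof -
  define Q where "Q j z \<longleftrightarrow>
     (\<Sum>i | to_nat_on UNIV i < to_nat_on UNIV j. h z $ i) \<le> v z * (\<Sum>i\<in>UNIV. h z $ i) \<and>
     v z * (\<Sum>i\<in>UNIV. h z $ i) < (\<Sum>i | to_nat_on UNIV i \<le> to_nat_on UNIV j. h z $ i)" for j :: 'd and z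
  have [measurable]: "Measurable.pred M (Q j)" for j unfolding Q_def by measurable
  have "(\<lambda>z. {j. Q j z}) \<in> M \<rightarrow>\<^sub>M count_space UNIV"
  proof (subst measurable_count_space_eq2, simp, safe)
    fix S :: "'d set"
    have "(\<lambda>z. {j. Q j z}) -` {S} \<inter> space M = {z \<in> space M. \<forall>j\<in>UNIV. Q j z \<longleftrightarrow> j \<in> S}" by auto
    also have "\<dots> \<in> sets M" by measurable
    finally show "(\<lambda>z. {j. Q j z}) -` {S} \<inter> space M \<in> sets M" .
  qed simp
  then have "(\<lambda>z. (\<lambda>S. THE j. j \<in> S) {j. Q j z}) \<in> M \<rightarrow>\<^sub>M count_space UNIV"
    by (rule measurable_compose) simp
  then show ?thesis by (simp add: split_coord_def Q_def)
qed

lemma borel_measurable_vec_lambda_if: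
  fixes l :: "'a \<Rightarrow> real^'d::finite"
  assumes [measurable]: "l \<in> borel_measurable M" "s \<in> borel_measurable M" "K \<in> M \<rightarrow>\<^sub>M count_space UNIV"
  shows "(\<lambda>z. \<chi> i. if i = K z then s z else l z $ i) \<in> borel_measurable M"
proof (subst borel_measurable_euclidean_space, rule ballI)
  fix b :: "real^'d" assume "b \<in> Basis"
  then obtain j where b: "b = axis j 1" by (auto simp: Basis_vec_def)
  have "(\<lambda>z. (\<chi> i. if i = K z then s z else l z $ i) \<bullet> b) = (\<lambda>z. if K z = j then s z else l z $ j)"
    by (auto simp: b inner_axis)
  also have "\<dots> \<in> borel_measurable M" by measurable
  finally show "(\<lambda>z. (\<chi> i. if i = K z then s z else l z $ i) \<bullet> b) \<in> borel_measurable M" .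
qed

lemma prob_space_mondrian_noise: "prob_space mondrian_noise"
  unfolding mondrian_noise_def
  by (intro prob_space_PiM prob_space_pair prob_space_exponential_density prob_space_uniform_measure) auto

lemma measurable_noise_component [measurable]:
  "(\<lambda>\<omega>. \<omega> p) \<in> mondrian_noise \<rightarrow>\<^sub>M borel \<Otimes>\<^sub>M (borel \<Otimes>\<^sub>M borel)"
proof -
  have "(\<lambda>\<omega>. \<omega> p) \<in> mondrian_noise \<rightarrow>\<^sub>M density lborel (exponential_density 1) \<Otimes>\<^sub>M
     (uniform_measure lborel {0..1} \<Otimes>\<^sub>M uniform_measure lborel {0..1})"
    unfolding mondrian_noise_def by (rule measurable_component_singleton) simp
  also have "\<dots> = mondrian_noise \<rightarrow>\<^sub>M borel \<Otimes>\<^sub>M (borel \<Otimes>\<^sub>M borel)"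
    by (intro measurable_cong_sets refl sets_pair_measure_cong) (auto simp: sets_lborel)
  finally show ?thesis .
qed

lemma measurable_grow:
  fixes l u :: "(bool list \<Rightarrow> node_noise) \<Rightarrow> real^'d::finite"
  assumes "t \<in> borel_measurable mondrian_noise"
    "l \<in> borel_measurable mondrian_noise" "u \<in> borel_measurable mondrian_noise"
  shows "Measurable.pred mondrian_noise (\<lambda>\<omega>. grow lam k \<omega> p (t \<omega>) (l \<omega>) (u \<omega>) = None) \<and>
    (\<lambda>\<omega>. case grow lam k \<omega> p (t \<omega>) (l \<omega>) (u \<omega>) of Some T \<Rightarrow> T | None \<Rightarrow> Leaf)
      \<in> mondrian_noise \<rightarrow>\<^sub>M tree_sigma (count_space UNIV \<Otimes>\<^sub>M borel)"
  using assms
proof (induction k arbitrary: p t l u)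
  case 0
  show ?case by simp
next
  case (Suc k)
  note [measurable] = Suc.prems
  define e where "e \<omega> = fst (\<omega> p)" for \<omega> :: "bool list \<Rightarrow> node_noise"
  define v where "v \<omega> = fst (snd (\<omega> p))" for \<omega> :: "bool list \<Rightarrow> node_noise"
  define w where "w \<omega> = snd (snd (\<omega> p))" for \<omega> :: "bool list \<Rightarrow> node_noise"
  have [measurable]: "e \<in> borel_measurable mondrian_noise" "v \<in> borel_measurable mondrian_noise"
    "w \<in> borel_measurable mondrian_noise" unfolding e_def v_def w_def by measurable
  define t' where "t' \<omega> = t \<omega> + e \<omega> / (\<Sum>i\<in>UNIV. u \<omega> $ i - l \<omega> $ i)" for \<omega>
  have [measurable]: "t' \<in> borel_measurable mondrian_noise" unfolding t'_def by measurable
  define K where "K \<omega> = split_coord (u \<omega> - l \<omega>) (v \<omega>)" for \<omega>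
  have [measurable]: "K \<in> mondrian_noise \<rightarrow>\<^sub>M count_space UNIV" unfolding K_def by measurable
  define S where "S \<omega> = l \<omega> $ K \<omega> + w \<omega> * (u \<omega> $ K \<omega> - l \<omega> $ K \<omega>)" for \<omega>
  have nth: "(\<lambda>\<omega>. g \<omega> $ K \<omega>) \<in> borel_measurable mondrian_noise"
    if [measurable]: "g \<in> borel_measurable mondrian_noise" for g :: "_ \<Rightarrow> real^'d"
    by (rule measurable_compose_countable'[where g = K and I = UNIV and f = "\<lambda>j \<omega>. g \<omega> $ j"]) auto
  note [measurable] = nth[OF Suc.prems(2)] nth[OF Suc.prems(3)]
  have [measurable]: "S \<in> borel_measurable mondrian_noise" unfolding S_def by measurable
  define u' where "u' \<omega> = (\<chi> i. if i = K \<omega> then S \<omega> else u \<omega> $ i)" for \<omega>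
  define l' where "l' \<omega> = (\<chi> i. if i = K \<omega> then S \<omega> else l \<omega> $ i)" for \<omega>
  have u'[measurable]: "u' \<in> borel_measurable mondrian_noise" and l'[measurable]: "l' \<in> borel_measurable mondrian_noise"
    unfolding u'_def l'_def by (intro borel_measurable_vec_lambda_if; measurable)+
  define A where "A \<omega> = grow lam k \<omega> (False # p) (t' \<omega>) (l \<omega>) (u' \<omega>)" for \<omega>
  define C where "C \<omega> = grow lam k \<omega> (True # p) (t' \<omega>) (l' \<omega>) (u \<omega>)" for \<omega>
  let ?c = "\<lambda>x. case x of Some T \<Rightarrow> T | None \<Rightarrow> Leaf"
  let ?N = "tree_sigma (count_space UNIV \<Otimes>\<^sub>M borel)"
  have A[measurable]: "Measurable.pred mondrian_noise (\<lambda>\<omega>. A \<omega> = None)" "(\<lambda>\<omega>. ?c (A \<omega>)) \<in> mondrian_noise \<rightarrow>\<^sub>M ?N"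
    using Suc.IH[of t' l u' "False # p"] by (auto simp: A_def)
  have C[measurable]: "Measurable.pred mondrian_noise (\<lambda>\<omega>. C \<omega> = None)" "(\<lambda>\<omega>. ?c (C \<omega>)) \<in> mondrian_noise \<rightarrow>\<^sub>M ?N"
    using Suc.IH[of t' l' u "True # p"] by (auto simp: C_def)
  have eq: "grow lam (Suc k) \<omega> p (t \<omega>) (l \<omega>) (u \<omega>) =
    (if lam < t' \<omega> then Some Leaf else if A \<omega> = None \<or> C \<omega> = None then None
     else Some (Node (?c (A \<omega>)) (K \<omega>, S \<omega>) (?c (C \<omega>))))" (is "_ = ?R \<omega>") for \<omega>
  proof -
    have "grow lam (Suc k) \<omega> p (t \<omega>) (l \<omega>) (u \<omega>) =
      (if lam < t' \<omega> then Some Leaf else case (A \<omega>, C \<omega>) of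
         (Some a, Some b) \<Rightarrow> Some (Node a (K \<omega>, S \<omega>) b) | _ \<Rightarrow> None)"
      unfolding A_def C_def u'_def l'_def S_def K_def t'_def e_def v_def w_def
      by (simp only: grow.simps Let_def case_prod_beta)
    also have "\<dots> = ?R \<omega>" by (cases "A \<omega>"; cases "C \<omega>") simp_all
    finally show ?thesis .
  qed
  have 1: "(\<lambda>\<omega>. grow lam (Suc k) \<omega> p (t \<omega>) (l \<omega>) (u \<omega>) = None) =
     (\<lambda>\<omega>. \<not> lam < t' \<omega> \<and> (A \<omega> = None \<or> C \<omega> = None))"
    unfolding eq by auto
  have 2: "(\<lambda>\<omega>. ?c (grow lam (Suc k) \<omega> p (t \<omega>) (l \<omega>) (u \<omega>))) =
     (\<lambda>\<omega>. if lam < t' \<omega> \<or> A \<omega> = None \<or> C \<omega> = None then Leaf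
           else Node (?c (A \<omega>)) (K \<omega>, S \<omega>) (?c (C \<omega>)))"
    unfolding eq by auto
  show ?case unfolding 1 2 by measurable
qed

lemma measurable_mondrian_tree [measurable]:
  "mondrian_tree lam \<in> mondrian_noise \<rightarrow>\<^sub>M tree_sigma (count_space (UNIV :: 'd::finite set) \<Otimes>\<^sub>M borel)"
proof -
  let ?N = "tree_sigma (count_space (UNIV :: 'd set) \<Otimes>\<^sub>M borel)"
  let ?T = "\<lambda>k \<omega>. grow lam k \<omega> [] 0 (0 :: real^'d) 1"
  have [measurable]: "Measurable.pred mondrian_noise (\<lambda>\<omega>. ?T k \<omega> = None)"
    "(\<lambda>\<omega>. case ?T k \<omega> of Some T \<Rightarrow> T | None \<Rightarrow> Leaf) \<in> mondrian_noise \<rightarrow>\<^sub>M ?N" for k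
    using measurable_grow[of "\<lambda>_. 0" "\<lambda>_. 0 :: real^'d" "\<lambda>_. 1" lam k "[]"] by auto
  have "(\<lambda>\<omega>. (\<lambda>k \<omega>. case ?T k \<omega> of Some T \<Rightarrow> T | None \<Rightarrow> Leaf) (LEAST k. ?T k \<omega> \<noteq> None) \<omega>)
     \<in> mondrian_noise \<rightarrow>\<^sub>M ?N"
    by (rule measurable_compose_countable) measurable
  moreover have "mondrian_tree lam = (\<lambda>\<omega>. (\<lambda>k \<omega>. case ?T k \<omega> of Some T \<Rightarrow> T | None \<Rightarrow> Leaf) (LEAST k. ?T k \<omega> \<noteq> None) \<omega>)"
    by (auto simp: mondrian_tree_def Let_def fun_eq_iff split: option.splits)
  ultimately show ?thesis by simp
qed

lemma prob_space_mondrian: "prob_space (mondrian lam)"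
  unfolding mondrian_def
  by (rule prob_space.prob_space_distr[OF prob_space_mondrian_noise measurable_mondrian_tree])


section \<open>Forests\<close>

definition tree_estimate ::
    "nat \<Rightarrow> 'd mtree \<Rightarrow> (nat \<Rightarrow> (real^'d) \<times> real) \<Rightarrow> real^'d::finite \<Rightarrow> real" where
  "tree_estimate n T D x =
     (\<Sum>i<n. snd (D i) * indicator (cell_at T x) (fst (D i))) /
     (\<Sum>i<n. indicator (cell_at T x) (fst (D i)))"

definition forest_estimate ::
    "nat \<Rightarrow> nat \<Rightarrow> (nat \<Rightarrow> 'd mtree) \<Rightarrow> (nat \<Rightarrow> (real^'d) \<times> real) \<Rightarrow> real^'d::finite \<Rightarrow> real" where
  "forest_estimate n B T D x = 1 / real B * (\<Sum>b<B. tree_estimate n (T b) D x)"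

definition debiased_estimate ::
    "nat \<Rightarrow> nat \<Rightarrow> nat \<Rightarrow> (nat \<Rightarrow> real) \<Rightarrow> (nat \<times> nat \<Rightarrow> 'd mtree) \<Rightarrow>
     (nat \<Rightarrow> (real^'d) \<times> real) \<Rightarrow> real^'d::finite \<Rightarrow> real" where
  "debiased_estimate n B J \<omega> T D x =
     (\<Sum>r\<le>J. \<omega> r * forest_estimate n B (\<lambda>b. T (b, r)) D x)"

definition debiasing_weights :: "nat \<Rightarrow> (nat \<Rightarrow> real) \<Rightarrow> (nat \<Rightarrow> real) \<Rightarrow> bool" where
  "debiasing_weights J a \<omega> \<longleftrightarrow>
     (\<Sum>r\<le>J. \<omega> r) = 1 \<and> (\<forall>s\<in>{1..J}. (\<Sum>r\<le>J. \<omega> r / a r ^ (2 * s)) = 0)"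

definition admissible_tuning :: "nat \<Rightarrow> (nat \<Rightarrow> real) \<Rightarrow> (nat \<Rightarrow> nat) \<Rightarrow> bool" where
  "admissible_tuning d lam B \<longleftrightarrow>
     (\<forall>n\<ge>1. 0 < lam n \<and> 1 \<le> B n) \<and>
     (\<lambda>n. ennreal (ln (real n) ^ 3)) \<lesssim> (\<lambda>n. ennreal (lam n)) \<and>
     filterlim (\<lambda>n. real n / lam n ^ d) at_top sequentially \<and>
     (\<lambda>n. ennreal (ln (real n) ^ d)) \<lesssim> (\<lambda>n. ennreal (real (B n)))"

text \<open>
  \<open>sample_space n P I Q\<close> is the joint law of \<open>n\<close> independent data points with law \<open>P\<close> and, independent
  of them, independent trees with laws \<open>Q i\<close> for \<open>i \<in> I\<close>. \<open>sigma_XT\<close> is the \<open>\<sigma>\<close>-algebra generated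
  by the covariates and the trees.
\<close>

definition sample_space ::
    "nat \<Rightarrow> ((real^'d) \<times> real) measure \<Rightarrow> 'i set \<Rightarrow> ('i \<Rightarrow> 'd mtree measure) \<Rightarrow>
     ((nat \<Rightarrow> (real^'d::finite) \<times> real) \<times> ('i \<Rightarrow> 'd mtree)) measure" where
  "sample_space n P I Q = (\<Pi>\<^sub>M i\<in>{..<n}. P) \<Otimes>\<^sub>M (\<Pi>\<^sub>M i\<in>I. Q i)"

definition sigma_XT ::
    "nat \<Rightarrow> ((real^'d) \<times> real) measure \<Rightarrow> 'i set \<Rightarrow> ('i \<Rightarrow> 'd mtree measure) \<Rightarrow>
     ((nat \<Rightarrow> (real^'d::finite) \<times> real) \<times> ('i \<Rightarrow> 'd mtree)) measure" where
  "sigma_XT n P I Q = vimage_algebra (space (sample_space n P I Q))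
     (\<lambda>(D, T). (\<lambda>i\<in>{..<n}. fst (D i), T)) ((\<Pi>\<^sub>M i\<in>{..<n}. borel) \<Otimes>\<^sub>M (\<Pi>\<^sub>M i\<in>I. Q i))"

definition cond_mean_XT ::
    "nat \<Rightarrow> ((real^'d) \<times> real) measure \<Rightarrow> 'i set \<Rightarrow> ('i \<Rightarrow> 'd mtree measure) \<Rightarrow>
     ((nat \<Rightarrow> (real^'d::finite) \<times> real) \<Rightarrow> ('i \<Rightarrow> 'd mtree) \<Rightarrow> real) \<Rightarrow>
     (nat \<Rightarrow> (real^'d) \<times> real) \<times> ('i \<Rightarrow> 'd mtree) \<Rightarrow> real" where
  "cond_mean_XT n P I Q m =
     real_cond_exp (sample_space n P I Q) (sigma_XT n P I Q) (\<lambda>(D, T). m D T)"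

text \<open>
  The bias expansion of the ordinary forest with \<open>B n\<close> trees of lifetime \<open>lam n\<close>, with coefficients
  \<open>c r\<close> in the role of \<open>B\<^sub>r(x)\<close>.
\<close>

definition bias_expansion ::
    "((real^'d::finite) \<times> real) measure \<Rightarrow> (real^'d \<Rightarrow> real) \<Rightarrow> real \<Rightarrow> real^'d \<Rightarrow> (nat \<Rightarrow> real) \<Rightarrow>
     (nat \<Rightarrow> real) \<Rightarrow> (nat \<Rightarrow> nat) \<Rightarrow> bool" where
  "bias_expansion P \<mu> \<beta> x c lam B \<longleftrightarrow>
     (\<lambda>n. \<integral>\<^sup>+ z. ennreal ((
            cond_mean_XT n P {..<B n} (\<lambda>_. mondrian (lam n))
              (\<lambda>D T. forest_estimate n (B n) T D x) z
            - \<mu> x - (\<Sum>r = 1..strict_floor \<beta> div 2. c r / lam n ^ (2 * r)))\<^sup>2)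
          \<partial>sample_space n P {..<B n} (\<lambda>_. mondrian (lam n)))
     \<lesssim>
     (\<lambda>n. ennreal (1 / lam n powr (2 * \<beta>)
            + 1 / (lam n powr (2 * min 1 \<beta>) * real (B n))
            + 1 / lam n powr (2 * min 1 \<beta>) * (lam n ^ CARD('d) / real n)))"

text \<open>
  The coefficients are common to all lifetime sequences proportional to \<open>lam\<close>. All these sequences are
  admissible if \<open>lam\<close> is, so coefficients for which the expansion holds along every admissible tuning
  satisfy this predicate. The converse is not required: with empty cells counted as estimate \<open>0\<close>,
  the expansion can fail for \<open>lam n ^ CARD('d) / real n\<close> tending to \<open>0\<close> too slowly, as an empty cell then
  contributes \<open>- \<mu> x\<close> too often.
\<close>

definition bias_coefficients ::
    "((real^'d::finite) \<times> real) measure \<Rightarrow> (real^'d \<Rightarrow> real) \<Rightarrow> real \<Rightarrow> real^'d \<Rightarrow>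
     (nat \<Rightarrow> real) \<Rightarrow> (nat \<Rightarrow> nat) \<Rightarrow> (nat \<Rightarrow> real) \<Rightarrow> bool" where
  "bias_coefficients P \<mu> \<beta> x lam B c \<longleftrightarrow> (\<forall>\<kappa>>0. bias_expansion P \<mu> \<beta> x c (\<lambda>n. \<kappa> * lam n) B)"

end

theory Submission
  imports Defs
begin

text \<open>
  The conditional mean of any linear combination of tree estimates given covariates and trees is the
  same combination with each response \<open>Y\<close> replaced by \<open>E[Y | X]\<close>. This explicit form depends on the
  forest of lifetime \<open>a r * lam n\<close> only through its own trees, so its law is the same as on the sample
  space of a single ordinary forest, and the ordinary bias expansion applies to each of the \<open>J + 1\<close>
  forests separately. Summed with the debiasing weights, the bias terms of order \<open>1, \<dots>, J\<close> cancel,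
  the term of order \<open>J + 1\<close> has coefficient \<open>\<omega>bar * c (J + 1)\<close>, and the remaining ones are
  \<open>O(lam n powr - (2 * J + 4))\<close>, since \<open>lam\<close> is bounded away from \<open>0\<close>.
\<close>

section \<open>The cell of a point as a measurable predicate of the tree\<close>

text \<open>Structural recursion along the path of \<open>x\<close> makes measurability in the tree
  accessible, which the definite description in \<open>cell_at\<close> does not.\<close>

primrec same_cell :: "real^'d::finite \<Rightarrow> real^'d \<Rightarrow> 'd mtree \<Rightarrow> bool" where
  "same_cell x y Leaf \<longleftrightarrow> True"
| "same_cell x y (Node l v r) \<longleftrightarrow>
     (if x $ fst v \<le> snd v then y $ fst v \<le> snd v \<and> same_cell x y l
      else snd v < y $ fst v \<and> same_cell x y r)"

lemma in_cells_imp_in: "C \<in> cells T D \<Longrightarrow> x \<in> C \<Longrightarrow> x \<in> D"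
  by (induction T D rule: cells.induct) auto

text \<open>Every cell lies inside the region being split, so at each node only the subtree on the
  side of \<open>x\<close> can contribute a cell containing \<open>x\<close>. The singleton form
  yields existence and uniqueness together, as the definite description in \<open>cell_at\<close>
  requires.\<close>

lemma cells_containing:
  assumes "x \<in> D"
  shows "{C \<in> cells T D. x \<in> C} = {{y \<in> D. same_cell x y T}}"
  using assms
proof (induction T D rule: cells.induct)
  case (1 D)
  then show ?case by auto
next
  case (2 a j s b D)
  show ?case
  proof (cases "x $ j \<le> s")
    case True
    have "{C \<in> cells (Node a (j, s) b) D. x \<in> C} = {C \<in> cells a {x \<in> D. x $ j \<le> s}. x \<in> C}"
      using True by (auto dest: in_cells_imp_in)
    also have "\<dots> = {{y \<in> {x \<in> D. x $ j \<le> s}. same_cell x y a}}"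
      using 2 True by simp
    finally show ?thesis using True by (simp add: conj_assoc)
  next
    case False
    have "{C \<in> cells (Node a (j, s) b) D. x \<in> C} = {C \<in> cells b {x \<in> D. s < x $ j}. x \<in> C}"
      using False by (auto dest: in_cells_imp_in)
    also have "\<dots> = {{y \<in> {x \<in> D. s < x $ j}. same_cell x y b}}"
      using 2 False by simp
    finally show ?thesis using False by (simp add: conj_assoc)
  qed
qed

lemma cell_at_eq:
  assumes "x \<in> cbox 0 1"
  shows "cell_at T x = {y \<in> cbox 0 1. same_cell x y T}"
  using cells_containing[OF assms, of T] unfolding cell_at_def by (intro the_equality) blast+

text \<open>The primitive recursor is the form in which measurability on \<open>tree_sigma\<close>
  can be derived node by node.\<close>

lemma same_cell_rec_tree:
  "same_cell x y T = rec_tree True (\<lambda>l v r a b.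
     if x $ fst v \<le> snd v then y $ fst v \<le> snd v \<and> a else snd v < y $ fst v \<and> b) T"
  by (induction T) auto

lemma pred_same_cell [measurable (raw)]:
  fixes y :: "'a \<Rightarrow> real^'d::finite"
  assumes [measurable]: "T \<in> M \<rightarrow>\<^sub>M tree_sigma (count_space UNIV \<Otimes>\<^sub>M borel)" "y \<in> borel_measurable M"
  shows "Measurable.pred M (\<lambda>z. same_cell x (y z) (T z))"
proof -
  \<comment> \<open>The split coordinate is read off the tree and hence varies with
    \<open>z\<close>; as it takes finitely many values, the projections to fixed coordinates can be
    glued.\<close>
  have nth: "(\<lambda>z. g z $ j z) \<in> borel_measurable N"
    if [measurable]: "g \<in> borel_measurable N" "j \<in> N \<rightarrow>\<^sub>M count_space UNIV"
    for N :: "'b measure" and g :: "_ \<Rightarrow> real^'d" and j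
    by (rule measurable_compose_countable'[where g = j and I = UNIV and f = "\<lambda>j z. g z $ j"]) auto
  note [measurable (raw)] = nth
  show ?thesis
    unfolding same_cell_rec_tree by measurable
qed

section \<open>Integrability of the response and the covariate sigma-algebra\<close>

text \<open>The second moment is the mean of the conditional second moment, hence finite, and on a
  probability space square integrability implies integrability.\<close>

lemma integrable_snd:
  assumes "prob_space P" and sets: "sets P = sets (borel :: ((real^'d::finite) \<times> real) measure)"
    and sub: "subalgebra P F"
    and bound: "AE z in P. nn_cond_exp P F (\<lambda>z. ennreal ((snd z)\<^sup>2)) z \<le> ennreal C"
  shows "integrable P snd"
proof -
  interpret prob_space P by fact
  interpret finite_measure_subalgebra P F by standard fact
  have [measurable]: "snd \<in> borel_measurable P"
    unfolding measurable_cong_sets[OF sets refl] borel_prod[symmetric] by simp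
  have "(\<integral>\<^sup>+z. ennreal ((snd z)\<^sup>2) \<partial>P) = (\<integral>\<^sup>+z. 1 * nn_cond_exp P F (\<lambda>z. ennreal ((snd z)\<^sup>2)) z \<partial>P)"
    by (subst nn_cond_exp_intg) auto
  also have "\<dots> \<le> (\<integral>\<^sup>+z. ennreal C \<partial>P)"
    using bound by (intro nn_integral_mono_AE) auto
  also have "\<dots> < \<infinity>" by (simp add: emeasure_space_1)
  finally have "integrable P (\<lambda>z. (snd z)\<^sup>2)"
    by (intro integrableI_bounded) auto
  then show ?thesis by (rule square_integrable_imp_integrable[rotated]) measurable
qed

lemma measurable_fst_sigma_X [measurable]: "fst \<in> sigma_X P \<rightarrow>\<^sub>M borel"
  unfolding sigma_X_def by (rule measurable_vimage_algebra1) auto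

lemma subalgebra_vimage_algebra:
  assumes "f \<in> M \<rightarrow>\<^sub>M N"
  shows "subalgebra M (vimage_algebra (space M) f N)"
  unfolding subalgebra_def
proof (intro conjI)
  show "sets (vimage_algebra (space M) f N) \<subseteq> sets M"
    using assms by (auto simp: sets_vimage_algebra2 measurable_space dest: measurable_sets)
qed simp

lemma subalgebra_sigma_X:
  assumes "sets P = sets borel"
  shows "subalgebra P (sigma_X P)"
  unfolding sigma_X_def
  by (rule subalgebra_vimage_algebra)
    (simp add: measurable_cong_sets[OF assms refl] borel_prod[symmetric])

text \<open>
  The conditional expectation is used in place of \<open>\<mu> \<circ> fst\<close>, which need not be measurable, as \<open>\<mu>\<close> is
  arbitrary outside the cube.
\<close>

definition regressed :: "((real^'d::finite) \<times> real) measure \<Rightarrow> (real^'d) \<times> real \<Rightarrow> (real^'d) \<times> real" where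
  "regressed P z = (fst z, real_cond_exp P (sigma_X P) snd z)"

section \<open>Tree estimates as weighted sums of responses\<close>

text \<open>Separates covariates from responses: the weights depend only on what is conditioned on.
  For an empty cell \<open>0 / 0 = 0\<close> makes all weights vanish, in agreement with
  \<open>tree_estimate\<close>.\<close>

definition tree_weight :: "nat \<Rightarrow> 'd mtree \<Rightarrow> (nat \<Rightarrow> real^'d::finite) \<Rightarrow> real^'d \<Rightarrow> nat \<Rightarrow> real" where
  "tree_weight n T X x i = indicator (cell_at T x) (X i) / (\<Sum>i<n. indicator (cell_at T x) (X i))"

lemma tree_estimate_eq_weights:
  "tree_estimate n T D x = (\<Sum>i<n. tree_weight n T (\<lambda>i. fst (D i)) x i * snd (D i))"
  unfolding tree_estimate_def tree_weight_def sum_divide_distrib by (simp add: mult.commute)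

text \<open>The numerator is one of the nonnegative summands of the denominator. The uniform bound
  provides the domination in the integrability arguments below.\<close>

lemma abs_tree_weight_le: "\<bar>tree_weight n T X x i\<bar> \<le> 1" if "i < n"
proof -
  have "indicator (cell_at T x) (X i) \<le> (\<Sum>i<n. indicator (cell_at T x) (X i) :: real)"
    using that by (intro member_le_sum) auto
  then show ?thesis
    by (auto simp: tree_weight_def divide_le_eq_1 intro: order_trans[OF abs_ge_zero] split: split_indicator)
qed

section \<open>Conditional means given covariates and trees\<close>

context
  fixes P :: "((real^'d::finite) \<times> real) measure" and n :: nat and I :: "'i set"
    and Q :: "'i \<Rightarrow> 'd mtree measure" and M F
  assumes prob_P: "prob_space P" and sets_P: "sets P = sets borel"
    and int_Y: "integrable P snd"
    and prob_Q: "\<And>i. i \<in> I \<Longrightarrow> prob_space (Q i)"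
    and sets_Q: "\<And>i. i \<in> I \<Longrightarrow> sets (Q i) = sets (tree_sigma (count_space UNIV \<Otimes>\<^sub>M borel))"
  defines "M \<equiv> sample_space n P I Q" and "F \<equiv> sigma_XT n P I Q"
begin

private lemma measurable_P [measurable]: "fst \<in> borel_measurable P" "snd \<in> borel_measurable P"
  unfolding measurable_cong_sets[OF sets_P refl] borel_prod[symmetric] by simp_all

private lemma prob_M: "prob_space M"
  unfolding M_def sample_space_def
  by (intro prob_space_pair prob_space_PiM prob_P prob_Q)

private lemma measurable_XT:
  "(\<lambda>(D, T). (\<lambda>i\<in>{..<n}. fst (D i), T)) \<in> M \<rightarrow>\<^sub>M (\<Pi>\<^sub>M i\<in>{..<n}. borel) \<Otimes>\<^sub>M (\<Pi>\<^sub>M i\<in>I. Q i)"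
  unfolding M_def sample_space_def by measurable

private lemma subalg_F: "subalgebra M F"
  using subalgebra_vimage_algebra[OF measurable_XT] by (simp add: F_def M_def sigma_XT_def)

private lemma measurable_XT_F:
  "(\<lambda>(D, T). (\<lambda>i\<in>{..<n}. fst (D i), T)) \<in> F \<rightarrow>\<^sub>M (\<Pi>\<^sub>M i\<in>{..<n}. borel) \<Otimes>\<^sub>M (\<Pi>\<^sub>M i\<in>I. Q i)"
  unfolding F_def sigma_XT_def
  by (rule measurable_vimage_algebra1) (use measurable_XT in \<open>auto simp: M_def measurable_def\<close>)

private lemma measurable_X_F: "(\<lambda>z. fst (fst z i)) \<in> borel_measurable F" if "i < n"
proof -
  have "(\<lambda>z. fst ((\<lambda>(D, T). (\<lambda>i\<in>{..<n}. fst (D i), T)) z) i) \<in> borel_measurable F"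
    by (rule measurable_compose[OF measurable_XT_F])
      (rule measurable_compose[OF measurable_fst measurable_component_singleton], use that in simp)
  then show ?thesis using that by (simp add: case_prod_beta)
qed

private lemma measurable_T_F: "(\<lambda>z. snd z k) \<in> F \<rightarrow>\<^sub>M tree_sigma (count_space UNIV \<Otimes>\<^sub>M borel)" if "k \<in> I"
proof -
  have "(\<lambda>z. snd ((\<lambda>(D, T). (\<lambda>i\<in>{..<n}. fst (D i), T)) z) k) \<in> F \<rightarrow>\<^sub>M Q k"
    by (rule measurable_compose[OF measurable_XT_F])
      (rule measurable_compose[OF measurable_snd measurable_component_singleton], use that in simp)
  then show ?thesis using that
    unfolding measurable_cong_sets[OF refl sets_Q[OF that]] by (simp add: case_prod_beta)
qed

private lemma measurable_tree_weight_F: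
  assumes "x \<in> cbox 0 1" "i < n" "k \<in> I"
  shows "(\<lambda>z. tree_weight n (snd z k) (\<lambda>i. fst (fst z i)) x i) \<in> borel_measurable F"
proof -
  note [measurable] = measurable_T_F[OF \<open>k \<in> I\<close>]
  have [measurable]: "(\<lambda>z. indicator (cell_at (snd z k) x) (fst (fst z i)) :: real) \<in> borel_measurable F"
    if i: "i < n" for i
  proof -
    note [measurable] = measurable_X_F[OF i]
    show ?thesis unfolding cell_at_eq[OF \<open>x \<in> cbox 0 1\<close>] indicator_def mem_Collect_eq by measurable
  qed
  show ?thesis unfolding tree_weight_def using assms by measurable
qed

private lemma measurable_regressed_F:
  assumes "i < n"
  shows "(\<lambda>z. snd (regressed P (fst z i))) \<in> borel_measurable F"
proof -
  have "(\<lambda>z. fst z i) \<in> F \<rightarrow>\<^sub>M sigma_X P"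
    unfolding sigma_X_def
  proof (rule measurable_vimage_algebra2)
    show "(\<lambda>z. fst z i) \<in> space F \<rightarrow> space P"
      using assms by (auto simp: F_def sigma_XT_def sample_space_def space_pair_measure space_PiM)
  qed (rule measurable_X_F[OF assms])
  then show ?thesis
    unfolding regressed_def snd_conv by (rule measurable_compose) (rule borel_measurable_cond_exp)
qed

text \<open>Observation \<open>i\<close> has law \<open>P\<close> under the product measure, and
  adjoining independent trees does not change the law of the data.\<close>

private lemma integrable_coordinate:
  fixes g :: "_ \<Rightarrow> real"
  assumes "i < n" "integrable P g"
  shows "integrable (\<Pi>\<^sub>M i\<in>{..<n}. P) (\<lambda>D. g (D i))" "integrable M (\<lambda>z. g (fst z i))"
proof -
  interpret Q: prob_space "\<Pi>\<^sub>M i\<in>I. Q i" by (intro prob_space_PiM prob_Q)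
  have d1: "distr (\<Pi>\<^sub>M i\<in>{..<n}. P) P (\<lambda>D. D i) = P"
    using assms(1) by (intro distr_PiM_component prob_P) auto
  have [measurable]: "g \<in> borel_measurable P" using assms by auto
  have "integrable (distr (\<Pi>\<^sub>M i\<in>{..<n}. P) P (\<lambda>D. D i)) g" unfolding d1 by fact
  then show 1: "integrable (\<Pi>\<^sub>M i\<in>{..<n}. P) (\<lambda>D. g (D i))"
    using assms(1) by (subst (asm) integrable_distr_eq) auto
  then have "integrable (distr M (\<Pi>\<^sub>M i\<in>{..<n}. P) fst) (\<lambda>D. g (D i))"
    unfolding M_def sample_space_def by (simp add: Q.distr_pair_fst)
  then show "integrable M (\<lambda>z. g (fst z i))"
    using assms(1) unfolding M_def sample_space_def by (subst (asm) integrable_distr_eq) auto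
qed

text \<open>By Fubini, freeze the trees and all observations other than \<open>i\<close>. Then
  \<open>H\<close> is a function of the covariate of observation \<open>i\<close> alone, and the
  defining property of the conditional expectation under \<open>P\<close> applies to each
  slice.\<close>

private lemma integral_mult_regressed:
  assumes i: "i < n" and H: "H \<in> borel_measurable F" and bound: "\<And>z. z \<in> space M \<Longrightarrow> \<bar>H z\<bar> \<le> C"
  shows "(\<integral>z. H z * snd (fst z i) \<partial>M) = (\<integral>z. H z * snd (regressed P (fst z i)) \<partial>M)"
proof -
  interpret P: prob_space P by (rule prob_P)
  interpret S: finite_measure_subalgebra P "sigma_X P"
    by standard (rule subalgebra_sigma_X[OF sets_P])
  let ?PD = "\<Pi>\<^sub>M i\<in>{..<n}. P" and ?PT = "\<Pi>\<^sub>M i\<in>I. Q i"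
  interpret D: prob_space ?PD by (intro prob_space_PiM prob_P)
  interpret T: prob_space ?PT by (intro prob_space_PiM prob_Q)
  interpret DT: pair_prob_space ?PD ?PT ..
  interpret PS: product_sigma_finite "\<lambda>_::nat. P" ..
  have M: "M = ?PD \<Otimes>\<^sub>M ?PT" by (simp add: M_def sample_space_def)
  have HM: "H \<in> borel_measurable M" by (rule measurable_from_subalg[OF subalg_F H])
  then have [measurable]: "H \<in> borel_measurable (?PD \<Otimes>\<^sub>M ?PT)" by (simp add: M)
  let ?m = "real_cond_exp P (sigma_X P) snd"
  define L where "L = {..<n} - {i}"
  have ins: "{..<n} = insert i L" and L: "finite L" "i \<notin> L" using i by (auto simp: L_def)
  \<comment> \<open>Kept general in \<open>g\<close>, because it is applied both to the response and
    to its conditional expectation.\<close>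
  have reduce: "(\<integral>z. H z * g (fst z i) \<partial>M) =
      (\<integral>T. (\<integral>D. (\<integral>y. H (D(i := y), T) * g y \<partial>P) \<partial>(\<Pi>\<^sub>M i\<in>L. P)) \<partial>?PT)"
    and integrable_slice: "\<And>D T. D \<in> space (\<Pi>\<^sub>M i\<in>L. P) \<Longrightarrow> T \<in> space ?PT \<Longrightarrow>
      integrable P (\<lambda>y. H (D(i := y), T) * g y)"
    if g: "integrable P g" for g :: "_ \<Rightarrow> real"
  proof -
    have [measurable]: "g \<in> borel_measurable P" using g by auto
    note [simp] = i
    have gi: "(\<lambda>D. g (D i)) \<in> borel_measurable ?PD" using i by measurable
    note [measurable] = gi
    have "integrable M (\<lambda>z. H z * g (fst z i))"
      by (rule Bochner_Integration.integrable_bound[OF integrable_mult_right[OF integrable_coordinate(2)[OF i g], of C]])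
        (use HM bound M in \<open>auto simp: abs_mult intro!: mult_mono order_trans[OF bound] AE_I2\<close>)
    moreover have "(\<lambda>z. H z * g (fst z i)) = (\<lambda>(D, T). H (D, T) * g (D i))" by auto
    ultimately have "(\<integral>z. H z * g (fst z i) \<partial>M) = (\<integral>T. (\<integral>D. H (D, T) * g (D i) \<partial>?PD) \<partial>?PT)"
      by (simp only: M) (rule DT.integral_snd[symmetric])
    also have "\<dots> = (\<integral>T. (\<integral>D. (\<integral>y. H (D(i := y), T) * g y \<partial>P) \<partial>(\<Pi>\<^sub>M i\<in>L. P)) \<partial>?PT)"
    proof (rule Bochner_Integration.integral_cong[OF refl])
      fix T assume T: "T \<in> space ?PT"
      note [measurable] = measurable_Pair2'[OF T]
      have "integrable ?PD (\<lambda>D. H (D, T) * g (D i))"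
        by (rule Bochner_Integration.integrable_bound[OF integrable_mult_right[OF integrable_coordinate(1)[OF i g], of C]])
          (use T in \<open>auto simp: abs_mult M space_pair_measure intro!: mult_mono order_trans[OF bound] AE_I2\<close>)
      then show "(\<integral>D. H (D, T) * g (D i) \<partial>?PD) = (\<integral>D. (\<integral>y. H (D(i := y), T) * g y \<partial>P) \<partial>(\<Pi>\<^sub>M i\<in>L. P))"
        unfolding ins by (subst PS.product_integral_insert) (auto simp: L)
    qed
    finally show "(\<integral>z. H z * g (fst z i) \<partial>M) =
      (\<integral>T. (\<integral>D. (\<integral>y. H (D(i := y), T) * g y \<partial>P) \<partial>(\<Pi>\<^sub>M i\<in>L. P)) \<partial>?PT)" .
    fix D T assume DT: "D \<in> space (\<Pi>\<^sub>M i\<in>L. P)" "T \<in> space ?PT"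
    have upd: "(\<lambda>y. (D(i := y), T)) \<in> P \<rightarrow>\<^sub>M ?PD \<Otimes>\<^sub>M ?PT"
      using DT unfolding ins by (intro measurable_Pair measurable_fun_upd[where J = L]) auto
    note [measurable] = measurable_compose[OF upd]
    have "(D(i := y), T) \<in> space M" if "y \<in> space P" for y
      using measurable_space[OF upd that] M by simp
    then show "integrable P (\<lambda>y. H (D(i := y), T) * g y)"
      by (intro Bochner_Integration.integrable_bound[OF integrable_mult_right[OF g, of C]])
        (auto simp: abs_mult intro!: mult_mono order_trans[OF bound] AE_I2)
  qed
  have "(\<integral>y. H (D(i := y), T) * ?m y \<partial>P) = (\<integral>y. H (D(i := y), T) * snd y \<partial>P)"
    if DT: "D \<in> space (\<Pi>\<^sub>M i\<in>L. P)" "T \<in> space ?PT" for D T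
  proof (rule S.real_cond_exp_intg(2))
    \<comment> \<open>With everything else frozen, the map generating \<open>F\<close> sees
      \<open>y\<close> only through its covariate.\<close>
    have "(\<lambda>y. (D(i := y), T)) \<in> sigma_X P \<rightarrow>\<^sub>M F"
      unfolding F_def sigma_XT_def
    proof (rule measurable_vimage_algebra2)
      have upd: "(\<lambda>y. (D(i := y), T)) \<in> P \<rightarrow>\<^sub>M ?PD \<Otimes>\<^sub>M ?PT"
        using DT unfolding ins by (intro measurable_Pair measurable_fun_upd[where J = L]) auto
      then show "(\<lambda>y. (D(i := y), T)) \<in> space (sigma_X P) \<rightarrow> space (sample_space n P I Q)"
        by (auto simp: sigma_X_def sample_space_def dest: measurable_space)
      have Dj: "D j \<in> space P" if "j < n" "j \<noteq> i" for j
        using DT that by (auto simp: space_PiM L_def)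
      have "(\<lambda>y. \<lambda>j\<in>{..<n}. fst ((D(i := y)) j)) \<in> sigma_X P \<rightarrow>\<^sub>M (\<Pi>\<^sub>M i\<in>{..<n}. borel)"
      proof (rule measurable_restrict)
        fix j show "(\<lambda>y. fst ((D(i := y)) j)) \<in> sigma_X P \<rightarrow>\<^sub>M borel"
          by (cases "j = i") simp_all
      qed
      then show "(\<lambda>y. case (D(i := y), T) of (D, T) \<Rightarrow> (\<lambda>i\<in>{..<n}. fst (D i), T))
          \<in> sigma_X P \<rightarrow>\<^sub>M (\<Pi>\<^sub>M i\<in>{..<n}. borel) \<Otimes>\<^sub>M ?PT"
        using DT(2) by simp
    qed
    then show "(\<lambda>y. H (D(i := y), T)) \<in> borel_measurable (sigma_X P)"
      by (rule measurable_compose) (rule H)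
    show "integrable P (\<lambda>y. H (D(i := y), T) * snd y)"
      by (rule integrable_slice[OF int_Y DT])
  qed auto
  then show ?thesis
    unfolding regressed_def snd_conv reduce[OF int_Y] reduce[OF S.real_cond_exp_int(1)[OF int_Y]]
    by (auto cong: Bochner_Integration.integral_cong)
qed

text \<open>The weights are bounded and \<open>F\<close>-measurable, so they pass through the
  conditional mean, which then acts on single responses. The arbitrary label set \<open>I\<close>
  covers both one ordinary forest and all trees of the debiased one.\<close>

lemma cond_mean_tree_estimates:
  assumes x: "x \<in> cbox 0 1" and K: "K \<subseteq> I"
  shows "AE z in M. cond_mean_XT n P I Q (\<lambda>D T. \<Sum>k\<in>K. c k * tree_estimate n (T k) D x) z =
      (\<Sum>k\<in>K. c k * tree_estimate n (snd z k) (\<lambda>i. regressed P (fst z i)) x)" (is "AE z in M. ?L z = ?R z")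
    and "(\<lambda>z. \<Sum>k\<in>K. c k * tree_estimate n (snd z k) (\<lambda>i. regressed P (fst z i)) x) \<in> borel_measurable M"
proof -
  interpret P: prob_space P by (rule prob_P)
  interpret M: prob_space M by (rule prob_M)
  interpret S: finite_measure_subalgebra P "sigma_X P"
    by standard (rule subalgebra_sigma_X[OF sets_P])
  interpret F: finite_measure_subalgebra M F by standard (rule subalg_F)
  define W where "W i z = (\<Sum>k\<in>K. c k * tree_weight n (snd z k) (\<lambda>i. fst (fst z i)) x i)"
    for i and z :: "(nat \<Rightarrow> (real^'d) \<times> real) \<times> ('i \<Rightarrow> 'd mtree)"
  define C where "C = (\<Sum>k\<in>K. \<bar>c k\<bar>)"
  have W: "W i \<in> borel_measurable F" if "i < n" for i
    unfolding W_def using measurable_tree_weight_F[OF x that] K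
    by (intro borel_measurable_sum borel_measurable_times) auto
  have WC: "\<bar>W i z\<bar> \<le> C" if "i < n" for i z
    unfolding W_def C_def
    by (rule order_trans[OF sum_abs]) (auto simp: abs_mult intro!: sum_mono mult_left_le abs_tree_weight_le[OF that])
  \<comment> \<open>\<open>D\<close> is any sample with the covariates of \<open>z\<close>, so the
    identity serves both the original data and the regressed data.\<close>
  have W_sum: "(\<Sum>k\<in>K. c k * tree_estimate n (snd z k) D x) = (\<Sum>i<n. W i z * snd (D i))"
    if "\<And>i. fst (D i) = fst (fst z i)" for z and D :: "nat \<Rightarrow> (real^'d) \<times> real"
    unfolding tree_estimate_eq_weights W_def sum_distrib_left sum_distrib_right that
    by (subst sum.swap) (simp add: mult.assoc)
  have R: "?R z = (\<Sum>i<n. W i z * snd (regressed P (fst z i)))" for z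
    by (rule W_sum) (simp add: regressed_def)
  have L: "(\<lambda>(D, T). \<Sum>k\<in>K. c k * tree_estimate n (T k) D x) = (\<lambda>z. \<Sum>i<n. W i z * snd (fst z i))"
    using W_sum by (fastforce simp: fun_eq_iff)
  have R_F: "?R \<in> borel_measurable F"
    unfolding R using W measurable_regressed_F by (intro borel_measurable_sum borel_measurable_times) auto
  then show "?R \<in> borel_measurable M" by (rule measurable_from_subalg[OF subalg_F])
  have int: "integrable M (\<lambda>z. H z * g (fst z i))"
    if "i < n" "integrable P g" "H \<in> borel_measurable F" "\<And>z. z \<in> space M \<Longrightarrow> \<bar>H z\<bar> \<le> C"
    for H i and g :: "_ \<Rightarrow> real"
    by (rule Bochner_Integration.integrable_bound[OF integrable_mult_right[OF integrable_coordinate(2)[OF that(1,2)], of C]])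
      (use integrable_coordinate(2)[OF that(1,2)] measurable_from_subalg[OF subalg_F that(3)] that(4) in
        \<open>auto simp: abs_mult intro!: mult_mono order_trans[OF that(4)] AE_I2\<close>)
  have int_reg: "integrable P (\<lambda>z. snd (regressed P z))"
    unfolding regressed_def snd_conv by (rule S.real_cond_exp_int(1)[OF int_Y])
  have "AE z in M. real_cond_exp M F (\<lambda>z. \<Sum>i<n. W i z * snd (fst z i)) z = ?R z"
  proof (rule F.real_cond_exp_charact)
    fix A assume A: "A \<in> sets F"
    \<comment> \<open>Absorbing the indicator of the test event into the weight preserves
      \<open>F\<close>-measurability and the bound \<open>C\<close>, so
      \<open>integral_mult_regressed\<close> applies termwise.\<close>
    have HA: "(\<lambda>z. indicator A z * W i z) \<in> borel_measurable F" if "i < n" for i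
      using A W[OF that] by measurable
    have HC: "\<bar>indicator A z * W i z\<bar> \<le> C" if "i < n" for i z
      using WC[OF that, of z] by (auto split: split_indicator intro: order_trans[OF abs_ge_zero])
    have "(\<integral>z\<in>A. (\<Sum>i<n. W i z * snd (fst z i)) \<partial>M) = (\<Sum>i<n. \<integral>z. (indicator A z * W i z) * snd (fst z i) \<partial>M)"
      unfolding set_lebesgue_integral_def real_scaleR_def sum_distrib_left mult.assoc[symmetric]
      by (rule Bochner_Integration.integral_sum) (use int[OF _ int_Y HA HC] in auto)
    also have "\<dots> = (\<Sum>i<n. \<integral>z. (indicator A z * W i z) * snd (regressed P (fst z i)) \<partial>M)"
      by (intro sum.cong refl integral_mult_regressed[OF _ HA HC]) auto
    also have "\<dots> = (\<integral>z\<in>A. ?R z \<partial>M)"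
      unfolding set_lebesgue_integral_def real_scaleR_def R sum_distrib_left mult.assoc[symmetric]
      by (rule Bochner_Integration.integral_sum[symmetric]) (use int[OF _ int_reg HA HC] in auto)
    finally show "(\<integral>z\<in>A. (\<Sum>i<n. W i z * snd (fst z i)) \<partial>M) = (\<integral>z\<in>A. ?R z \<partial>M)" .
  next
    show "integrable M (\<lambda>z. \<Sum>i<n. W i z * snd (fst z i))"
      by (rule Bochner_Integration.integrable_sum) (use int[OF _ int_Y W WC] in auto)
    show "integrable M ?R" unfolding R
      by (rule Bochner_Integration.integrable_sum) (use int[OF _ int_reg W WC] in auto)
  qed (rule R_F)
  then show "AE z in M. ?L z = ?R z"
    unfolding cond_mean_XT_def L M_def F_def .
qed

end

section \<open>Calculus of asymptotic comparison\<close>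

lemma lesssim_mono:
  fixes f g :: "nat \<Rightarrow> ennreal"
  assumes "\<And>n. 1 \<le> n \<Longrightarrow> f n \<le> ennreal C * g n"
  shows "f \<lesssim> g"
  using assms unfolding lesssim_def by blast

lemma lesssim_trans [trans]:
  fixes f g h :: "nat \<Rightarrow> ennreal"
  assumes "f \<lesssim> g" "g \<lesssim> h"
  shows "f \<lesssim> h"
proof -
  obtain C D where C: "\<And>n. 1 \<le> n \<Longrightarrow> f n \<le> ennreal C * g n" and D: "\<And>n. 1 \<le> n \<Longrightarrow> g n \<le> ennreal D * h n"
    using assms unfolding lesssim_def by blast
  \<comment> \<open>Constants of a comparison may be negative and are then truncated to
    \<open>0\<close> by \<open>ennreal\<close>; the maximum with \<open>0\<close> keeps
    \<open>ennreal\<close> multiplicative.\<close>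
  have "f n \<le> ennreal (max 0 C * D) * h n" if "1 \<le> n" for n
  proof -
    have "f n \<le> ennreal C * (ennreal D * h n)"
      using C[OF that] mult_left_mono[OF D[OF that]] by (rule order_trans) simp
    also have "\<dots> = ennreal (max 0 C * D) * h n"
      by (simp add: ennreal_mult'' ennreal_mult' mult.assoc max_def ennreal_neg)
    finally show ?thesis .
  qed
  then show ?thesis by (rule lesssim_mono)
qed

lemma lesssim_add:
  fixes f g h :: "nat \<Rightarrow> ennreal"
  assumes "f \<lesssim> h" "g \<lesssim> h"
  shows "(\<lambda>n. f n + g n) \<lesssim> h"
proof -
  obtain C D where C: "\<And>n. 1 \<le> n \<Longrightarrow> f n \<le> ennreal C * h n" and D: "\<And>n. 1 \<le> n \<Longrightarrow> g n \<le> ennreal D * h n"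
    using assms unfolding lesssim_def by blast
  have "f n + g n \<le> ennreal (max 0 C + max 0 D) * h n" if "1 \<le> n" for n
  proof -
    have "f n + g n \<le> ennreal C * h n + ennreal D * h n"
      using C[OF that] D[OF that] by (rule add_mono)
    also have "\<dots> = ennreal (max 0 C + max 0 D) * h n"
      by (simp add: ennreal_plus distrib_right max_def ennreal_neg)
    finally show ?thesis .
  qed
  then show ?thesis by (rule lesssim_mono)
qed

lemma lesssim_zero: "(\<lambda>_. 0 :: ennreal) \<lesssim> h"
  by (rule lesssim_mono) simp

lemma lesssim_sum:
  fixes f :: "'i \<Rightarrow> nat \<Rightarrow> ennreal"
  assumes "\<And>r. r \<in> A \<Longrightarrow> f r \<lesssim> h"
  shows "(\<lambda>n. \<Sum>r\<in>A. f r n) \<lesssim> h"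
  using assms by (induction A rule: infinite_finite_induct) (simp_all add: lesssim_zero lesssim_add)

lemma lesssim_cmult:
  fixes f h :: "nat \<Rightarrow> ennreal"
  assumes "f \<lesssim> h"
  shows "(\<lambda>n. ennreal k * f n) \<lesssim> h"
  by (rule lesssim_trans[OF lesssim_mono assms]) (rule order_refl)

section \<open>Lower bound for the lifetimes and comparison of rates\<close>

text \<open>For \<open>n\<close> at least \<open>2\<close> the logarithmic growth condition gives a
  uniform bound. At \<open>n = 1\<close> it is void, since \<open>ln 1 = 0\<close>, and positivity
  of \<open>lam 1\<close> takes over.\<close>

lemma admissible_tuning_lower_bound:
  assumes "admissible_tuning d lam B"
  shows "\<exists>l>0. \<forall>n\<ge>1. l \<le> lam n"
proof -
  obtain C where C: "\<And>n. 1 \<le> n \<Longrightarrow> ennreal (ln (real n) ^ 3) \<le> ennreal C * ennreal (lam n)"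
    and pos: "\<And>n. 1 \<le> n \<Longrightarrow> 0 < lam n"
    using assms unfolding admissible_tuning_def lesssim_def by blast
  have le: "ln 2 ^ 3 \<le> C * lam n" if "2 \<le> n" for n
  proof -
    have "ennreal (ln (real n) ^ 3) \<le> ennreal (C * lam n)"
      using C[of n] that pos[of n] by (simp add: ennreal_mult'')
    moreover have "0 < ln (real n) ^ 3" using that by simp
    ultimately have "ln (real n) ^ 3 \<le> C * lam n"
      by (subst (asm) ennreal_le_iff2) linarith
    moreover have "ln 2 ^ 3 \<le> ln (real n) ^ 3"
      using that by (intro power_mono) auto
    ultimately show ?thesis by linarith
  qed
  have "0 < ln (2::real) ^ 3" by simp
  \<comment> \<open>The comparison constant has no prescribed sign; the case \<open>n = 2\<close>
    forces it to be positive.\<close>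
  then have "0 < C * lam 2" using le[of 2] by linarith
  then have C0: "0 < C" using pos[of 2] by (simp add: zero_less_mult_iff)
  show ?thesis
  proof (intro exI conjI allI impI)
    show "0 < min (lam 1) (ln 2 ^ 3 / C)" using pos[of 1] C0 by simp
    fix n :: nat assume "1 \<le> n"
    then consider "n = 1" | "2 \<le> n" by linarith
    then show "min (lam 1) (ln 2 ^ 3 / C) \<le> lam n"
    proof cases
      case 2
      then have "ln 2 ^ 3 / C \<le> lam n" using le[of n] C0 by (simp add: pos_divide_le_eq mult.commute)
      then show ?thesis by linarith
    qed simp
  qed
qed

text \<open>Lifetimes may lie below \<open>1\<close>, so lowering the exponent from \<open>q\<close>
  to \<open>p\<close> costs a constant depending on the lower bound \<open>l0\<close>.\<close>

lemma inverse_powr_le: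
  fixes l :: real
  assumes "0 < l0" "l0 \<le> l" "p \<le> q"
  shows "1 / l powr q \<le> (1 / l0 powr (q - p)) * (1 / l powr p)"
proof -
  have "l0 powr (q - p) \<le> l powr (q - p)" using assms by (intro powr_mono2) auto
  then have "l0 powr (q - p) * l powr p \<le> l powr (q - p) * l powr p" by (intro mult_right_mono) auto
  also have "\<dots> = l powr q" by (simp flip: powr_add)
  finally have "1 / l powr q \<le> 1 / (l0 powr (q - p) * l powr p)"
    using assms by (intro divide_left_mono) auto
  then show ?thesis by simp
qed

text \<open>Compares the rate of an ordinary forest of lifetime \<open>k * l\<close> with the target
  rate at base lifetime \<open>l\<close>. Each of the three terms has its own constant, and their
  sum serves for all of them.\<close>

lemma bias_rate_rescale:
  fixes l k p q b e :: real
  assumes "0 < l0" "l0 \<le> l" "0 < k" "p \<le> q" "0 < b" "0 < n"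
  shows "1 / (k * l) powr q + 1 / ((k * l) powr e * b) + 1 / (k * l) powr e * ((k * l) ^ d / n)
    \<le> (1 / (k powr q * l0 powr (q - p)) + 1 / k powr e + k ^ d / k powr e)
      * (1 / l powr p + 1 / (l powr e * b) + 1 / l powr e * (l ^ d / n))"
    (is "?a + ?b + ?c \<le> (?A + ?B + ?C) * (?x + ?y + ?z)")
proof -
  have l: "0 < l" using assms by linarith
  have "?a = 1 / k powr q * (1 / l powr q)"
    using l assms by (simp add: powr_mult)
  also have "\<dots> \<le> 1 / k powr q * ((1 / l0 powr (q - p)) * (1 / l powr p))"
    using inverse_powr_le[OF assms(1,2,4)] by (intro mult_left_mono) auto
  finally have a: "?a \<le> ?A * ?x" by simp
  have b: "?b = ?B * ?y" using l assms by (simp add: powr_mult)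
  have c: "?c = ?C * ?z" using l assms by (simp add: powr_mult power_mult_distrib)
  have "0 \<le> ?A" "0 \<le> ?B" "0 \<le> ?C" "0 \<le> ?x" "0 \<le> ?y" "0 \<le> ?z" using assms l by auto
  then have "?A * ?x \<le> (?A + ?B + ?C) * ?x" "?B * ?y \<le> (?A + ?B + ?C) * ?y" "?C * ?z \<le> (?A + ?B + ?C) * ?z"
    by (intro mult_right_mono; linarith)+
  then show ?thesis using a b c by (simp only: distrib_left)
qed

section \<open>Cancellation of bias terms and the remainder\<close>

text \<open>After exchanging the sums, order \<open>s\<close> carries the factor
  \<open>\<Sum>r\<le>J. w r / a r ^ (2 * s)\<close>, which the weights make vanish for
  \<open>s\<close> from \<open>1\<close> to \<open>J\<close>. Order \<open>J + 1\<close> is split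
  off as the leading term.\<close>

lemma debiasing_weights_sum_bias:
  assumes weights: "debiasing_weights J a w"
    and wbar: "wbar = (\<Sum>r\<le>J. w r / a r ^ (2 * J + 2))"
    and beta: "0 < \<beta>" and m: "m = strict_floor \<beta> div 2"
  shows "(\<Sum>r\<le>J. w r * (\<Sum>s = 1..m. c s / (a r * l) ^ (2 * s))) =
    (if 2 * real J + 2 < \<beta> then wbar * c (J + 1) / l ^ (2 * J + 2) else 0) +
    (\<Sum>s = J + 2..m. c s * (\<Sum>r\<le>J. w r / a r ^ (2 * s)) / l ^ (2 * s))"
proof -
  define g where "g s = c s * (\<Sum>r\<le>J. w r / a r ^ (2 * s)) / l ^ (2 * s)" for s
  have zero: "g s = 0" if "s \<in> {1..J}" for s
    using weights that by (simp add: g_def debiasing_weights_def)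
  have "(\<Sum>r\<le>J. w r * (\<Sum>s = 1..m. c s / (a r * l) ^ (2 * s))) = (\<Sum>s = 1..m. g s)"
    unfolding g_def sum_distrib_left sum_divide_distrib
    by (subst sum.swap) (simp add: power_mult_distrib mult_ac)
  also have "\<dots> = (\<Sum>s = J + 1..m. g s)"
    using zero by (intro sum.mono_neutral_right) auto
  also have "\<dots> = (if J + 1 \<le> m then g (J + 1) else 0) + (\<Sum>s = J + 2..m. g s)"
    by (auto simp: sum.atLeast_Suc_atMost)
  \<comment> \<open>The source of the indicator: \<open>strict_floor \<beta>\<close> is the largest
    integer strictly below \<open>\<beta>\<close>, and halving with truncation is harmless because
    \<open>2 * J + 2\<close> is even.\<close>
  also have "J + 1 \<le> m \<longleftrightarrow> 2 * real J + 2 < \<beta>"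
  proof -
    have "J + 1 \<le> m \<longleftrightarrow> 2 * J + 2 \<le> strict_floor \<beta>" unfolding m by linarith
    also have "\<dots> \<longleftrightarrow> 2 * real J + 2 < \<beta>"
      unfolding strict_floor_def by linarith
    finally show ?thesis .
  qed
  also have "g (J + 1) = wbar * c (J + 1) / l ^ (2 * J + 2)" by (simp add: g_def wbar)
  finally show ?thesis unfolding g_def .
qed

lemma power2_le_if_abs_le: "\<bar>u\<bar> \<le> v \<Longrightarrow> u\<^sup>2 \<le> v\<^sup>2" for u v :: real
  using power_mono[of "\<bar>u\<bar>" v 2] by simp

text \<open>From each term the power \<open>l ^ (2 * J + 4)\<close> is split off and the remaining
  power of \<open>l\<close> is bounded below by that of \<open>l0\<close>. If there is no term, the
  left-hand side is \<open>0\<close>.\<close>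

lemma higher_order_bias_bound:
  fixes l :: real
  assumes "0 < l0" "l0 \<le> l" "0 < \<beta>" and m: "m = strict_floor \<beta> div 2"
  shows "(\<Sum>s = J + 2..m. c s / l ^ (2 * s))\<^sup>2
    \<le> (\<Sum>s = J + 2..m. \<bar>c s\<bar> / l0 ^ (2 * (s - (J + 2))))\<^sup>2 * (1 / l powr (2 * min (2 * real J + 4) \<beta>))"
proof (cases "J + 2 \<le> m")
  case True
  have l: "0 < l" using assms by linarith
  let ?K = "\<Sum>s = J + 2..m. \<bar>c s\<bar> / l0 ^ (2 * (s - (J + 2)))"
  have "2 * J + 4 \<le> strict_floor \<beta>" using True unfolding m by linarith
  \<comment> \<open>A nonempty sum forces \<open>2 * J + 4 < \<beta>\<close>, so the minimum is
    attained by the first argument.\<close>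
  then have min: "min (2 * real J + 4) \<beta> = real (2 * J + 4)"
    unfolding strict_floor_def by linarith
  have "\<bar>\<Sum>s = J + 2..m. c s / l ^ (2 * s)\<bar> \<le> (\<Sum>s = J + 2..m. \<bar>c s\<bar> / l0 ^ (2 * (s - (J + 2))) * (1 / l ^ (2 * J + 4)))"
  proof (rule order_trans[OF sum_abs], rule sum_mono)
    fix s assume "s \<in> {J + 2..m}"
    then have "J + 2 \<le> s" by simp
    then have "2 * s = 2 * (s - (J + 2)) + (2 * J + 4)" by arith
    then have "l ^ (2 * s) = l ^ (2 * (s - (J + 2))) * l ^ (2 * J + 4)" by (metis power_add)
    moreover have "l0 ^ (2 * (s - (J + 2))) * l ^ (2 * J + 4) \<le> l ^ (2 * (s - (J + 2))) * l ^ (2 * J + 4)"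
      using assms by (intro mult_right_mono power_mono) auto
    ultimately have "\<bar>c s\<bar> / l ^ (2 * s) \<le> \<bar>c s\<bar> / (l0 ^ (2 * (s - (J + 2))) * l ^ (2 * J + 4))"
      using l assms by (intro divide_left_mono) auto
    then show "\<bar>c s / l ^ (2 * s)\<bar> \<le> \<bar>c s\<bar> / l0 ^ (2 * (s - (J + 2))) * (1 / l ^ (2 * J + 4))"
      using l by (simp add: abs_divide)
  qed
  also have "\<dots> = ?K * (1 / l ^ (2 * J + 4))" by (simp only: sum_distrib_right)
  finally have "(\<Sum>s = J + 2..m. c s / l ^ (2 * s))\<^sup>2 \<le> (?K * (1 / l ^ (2 * J + 4)))\<^sup>2"
    by (rule power2_le_if_abs_le)
  also have "\<dots> = ?K\<^sup>2 * (1 / l ^ (2 * (2 * J + 4)))"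
    by (simp only: power_mult_distrib power_one_over power_even_eq)
  also have "l ^ (2 * (2 * J + 4)) = l powr (2 * min (2 * real J + 4) \<beta>)"
    unfolding min using powr_realpow[OF l, of "2 * (2 * J + 4)"] by simp
  finally show ?thesis .
qed simp

section \<open>From the trees of all forests to those of one\<close>

lemma prob_space_sample_space:
  assumes "prob_space P" "\<And>i. i \<in> I \<Longrightarrow> prob_space (Q i)"
  shows "prob_space (sample_space n P I Q)"
  unfolding sample_space_def by (intro prob_space_pair prob_space_PiM assms)

lemma measurable_reindex_trees:
  assumes "f \<in> I \<rightarrow> K"
  shows "(\<lambda>(D, T). (D, \<lambda>i\<in>I. T (f i))) \<in> sample_space n P K Q \<rightarrow>\<^sub>M sample_space n P I (\<lambda>i. Q (f i))"
  using assms unfolding sample_space_def by (auto simp: Pi_iff intro!: measurable_restrict)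

text \<open>Injectivity keeps the selected trees independent, and the data are left untouched. With
  \<open>f\<close> sending \<open>b\<close> to \<open>(b, r)\<close>, this identifies the law of
  forest \<open>r\<close> within the debiased sample with that of an ordinary forest.\<close>

lemma distr_sample_space_reindex:
  assumes P: "prob_space P" and Q: "\<And>k. k \<in> K \<Longrightarrow> prob_space (Q k)"
    and f: "inj_on f I" "f \<in> I \<rightarrow> K"
  shows "distr (sample_space n P K Q) (sample_space n P I (\<lambda>i. Q (f i))) (\<lambda>(D, T). (D, \<lambda>i\<in>I. T (f i)))
    = sample_space n P I (\<lambda>i. Q (f i))"
proof -
  have re: "distr (\<Pi>\<^sub>M k\<in>K. Q k) (\<Pi>\<^sub>M i\<in>I. Q (f i)) (\<lambda>T. \<lambda>i\<in>I. T (f i)) = (\<Pi>\<^sub>M i\<in>I. Q (f i))"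
    by (rule distr_PiM_reindex[OF Q f])
  have "prob_space (\<Pi>\<^sub>M i\<in>I. Q (f i))" using Q f by (intro prob_space_PiM) auto
  then have "sigma_finite_measure (distr (\<Pi>\<^sub>M k\<in>K. Q k) (\<Pi>\<^sub>M i\<in>I. Q (f i)) (\<lambda>T. \<lambda>i\<in>I. T (f i)))"
    unfolding re by (rule prob_space_imp_sigma_finite)
  from pair_measure_distr[OF measurable_ident _ this, of "\<Pi>\<^sub>M i\<in>{..<n}. P"]
  show ?thesis
    using f unfolding sample_space_def re
    by (simp add: distr_id[unfolded id_def] id_def measurable_restrict Pi_iff)
qed

section \<open>Bias expansion of the debiased forest\<close>

lemma forest_estimate_eq_sum:
  "forest_estimate n B T D x = (\<Sum>b<B. 1 / real B * tree_estimate n (T b) D x)"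
  by (simp add: forest_estimate_def sum_distrib_left)

text \<open>With the pair \<open>(b, r)\<close> as tree label, the estimate is a single linear
  combination of tree estimates, as \<open>cond_mean_tree_estimates\<close> requires.\<close>

lemma debiased_estimate_eq_sum:
  "debiased_estimate n B J w T D x =
     (\<Sum>k\<in>{..<B} \<times> {..J}. w (snd k) / real B * tree_estimate n (T k) D x)"
  unfolding debiased_estimate_def forest_estimate_def sum_distrib_left
  by (subst sum.swap) (simp add: sum.cartesian_product case_prod_beta)

theorem lemma4:
  fixes P :: "((real^'d::finite) \<times> real) measure"
    and f \<mu> \<sigma>2 :: "real^'d \<Rightarrow> real"
    and \<beta>\<^sub>f \<beta>\<^sub>\<mu> \<beta>\<^sub>\<sigma> \<beta> \<omega>bar :: real
    and x :: "real^'d"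
    and lam :: "nat \<Rightarrow> real" and B :: "nat \<Rightarrow> nat"
    and c :: "nat \<Rightarrow> real"
    and J :: nat and a \<omega> :: "nat \<Rightarrow> real"
  assumes data: "regression_model P f \<mu> \<sigma>2 \<beta>\<^sub>f \<beta>\<^sub>\<mu> \<beta>\<^sub>\<sigma>"
    and beta: "\<beta> = min \<beta>\<^sub>\<mu> (\<beta>\<^sub>f + 1)"
    and point: "x \<in> box 0 1"
    and tuning: "admissible_tuning CARD('d) lam B"
    and coefficients: "bias_coefficients P \<mu> \<beta> x lam B c"
    and lifetimes: "\<forall>r\<le>J. 0 < a r" "inj_on a {..J}"
    and weights: "debiasing_weights J a \<omega>"
    and omega_bar: "\<omega>bar = (\<Sum>r\<le>J. \<omega> r / a r ^ (2 * J + 2))"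
  shows "(\<lambda>n. \<integral>\<^sup>+ z. ennreal ((
              cond_mean_XT n P ({..<B n} \<times> {..J}) (\<lambda>(b, r). mondrian (a r * lam n))
                (\<lambda>D T. debiased_estimate n (B n) J \<omega> T D x) z
              - \<mu> x
              - (if 2 * real J + 2 < \<beta> then \<omega>bar * c (J + 1) / lam n ^ (2 * J + 2) else 0))\<^sup>2)
            \<partial>sample_space n P ({..<B n} \<times> {..J}) (\<lambda>(b, r). mondrian (a r * lam n)))
       \<lesssim>
       (\<lambda>n. ennreal (1 / lam n powr (2 * min (2 * real J + 4) \<beta>)
              + 1 / (lam n powr (2 * min 1 \<beta>) * real (B n))
              + 1 / lam n powr (2 * min 1 \<beta>) * (lam n ^ CARD('d) / real n)))"
proof -
  have P: "prob_space P" and sets_P: "sets P = sets borel"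
    and \<beta>0: "0 < \<beta>"
    using data beta by (auto simp: regression_model_def)
  obtain C0 where "AE z in P. nn_cond_exp P (sigma_X P) (\<lambda>z. ennreal ((snd z)\<^sup>2)) z \<le> ennreal C0"
    using data unfolding regression_model_def by blast
  then have int_Y: "integrable P snd"
    by (rule integrable_snd[OF P sets_P subalgebra_sigma_X[OF sets_P]])
  have x: "x \<in> cbox 0 1" using point box_subset_cbox by blast
  obtain l0 where l0: "0 < l0" "\<And>n. 1 \<le> n \<Longrightarrow> l0 \<le> lam n"
    using admissible_tuning_lower_bound[OF tuning] by blast
  have pos: "0 < lam n" "1 \<le> B n" if "1 \<le> n" for n
    using tuning that unfolding admissible_tuning_def by auto
  have sets_mondrian: "sets (mondrian l :: 'd mtree measure) = sets (tree_sigma (count_space UNIV \<Otimes>\<^sub>M borel))" for l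
    by (simp add: mondrian_def)
  define m where "m = strict_floor \<beta> div 2"
  \<comment> \<open>\<open>S r n\<close> is the bias polynomial of forest \<open>r\<close>,
    \<open>I n\<close> the term that survives debiasing, and \<open>R n\<close> the bias of order
    \<open>J + 2\<close> and above.\<close>
  define S where "S r n = (\<Sum>s = 1..m. c s / (a r * lam n) ^ (2 * s))" for r n
  define I where "I n = (if 2 * real J + 2 < \<beta> then \<omega>bar * c (J + 1) / lam n ^ (2 * J + 2) else 0)" for n
  define R where "R n = (\<Sum>s = J + 2..m. c s * (\<Sum>r\<le>J. \<omega> r / a r ^ (2 * s)) / lam n ^ (2 * s))" for n
  define SS where "SS r n = sample_space n P {..<B n} (\<lambda>_. mondrian (a r * lam n) :: 'd mtree measure)" for r n
  define SB where "SB n = sample_space n P ({..<B n} \<times> {..J}) (\<lambda>(b, r). mondrian (a r * lam n) :: 'd mtree measure)" for n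
  \<comment> \<open>Conditional means on different sample spaces cannot be compared directly.
    \<open>G n\<close> is a version given by a formula in data and trees, so it can be pulled back
    along \<open>\<pi> r n\<close>, which extracts forest \<open>r\<close>.\<close>
  define G where "G n z = (\<Sum>b<B n. 1 / real (B n) * tree_estimate n (snd z b) (\<lambda>i. regressed P (fst z i)) x)"
    for n and z :: "(nat \<Rightarrow> (real^'d) \<times> real) \<times> (nat \<Rightarrow> 'd mtree)"
  define \<pi> where "\<pi> r n = (\<lambda>(D :: nat \<Rightarrow> (real^'d) \<times> real, T :: nat \<times> nat \<Rightarrow> 'd mtree). (D, \<lambda>b\<in>{..<B n}. T (b, r)))"
    for r n
  define E where "E r n = (\<integral>\<^sup>+ z. ennreal ((G n z - \<mu> x - S r n)\<^sup>2) \<partial>SS r n)" for r n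
  let ?rate = "\<lambda>n. ennreal (1 / lam n powr (2 * min (2 * real J + 4) \<beta>)
              + 1 / (lam n powr (2 * min 1 \<beta>) * real (B n))
              + 1 / lam n powr (2 * min 1 \<beta>) * (lam n ^ CARD('d) / real n))"

  have E_le: "E r \<lesssim> ?rate" if r: "r \<le> J" for r
  proof -
    have ar: "0 < a r" using lifetimes(1) r by blast
    have expansion: "bias_expansion P \<mu> \<beta> x c (\<lambda>n. a r * lam n) B"
      using coefficients ar by (simp add: bias_coefficients_def)
    have G_AE: "AE z in SS r n. cond_mean_XT n P {..<B n} (\<lambda>_. mondrian (a r * lam n))
        (\<lambda>D T. forest_estimate n (B n) T D x) z = G n z" for n
      unfolding SS_def G_def forest_estimate_eq_sum
      by (rule cond_mean_tree_estimates(1)[OF P sets_P int_Y prob_space_mondrian sets_mondrian x order_refl])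
    have "E r n = (\<integral>\<^sup>+ z. ennreal ((cond_mean_XT n P {..<B n} (\<lambda>_. mondrian (a r * lam n))
        (\<lambda>D T. forest_estimate n (B n) T D x) z - \<mu> x - S r n)\<^sup>2) \<partial>SS r n)" for n
      unfolding E_def using G_AE[of n] by (intro nn_integral_cong_AE) auto
    then have "E r \<lesssim> (\<lambda>n. ennreal (1 / (a r * lam n) powr (2 * \<beta>)
        + 1 / ((a r * lam n) powr (2 * min 1 \<beta>) * real (B n))
        + 1 / (a r * lam n) powr (2 * min 1 \<beta>) * ((a r * lam n) ^ CARD('d) / real n)))"
      using expansion unfolding bias_expansion_def S_def SS_def m_def by presburger
    also have "\<dots> \<lesssim> ?rate"
    proof (rule lesssim_mono)
      fix n :: nat assume n: "1 \<le> n"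
      \<comment> \<open>The constant of \<open>bias_rate_rescale\<close> with factor
        \<open>a r\<close>; the exponent drops from \<open>2 * \<beta>\<close> to the one in the
        target rate.\<close>
      let ?k = "1 / (a r powr (2 * \<beta>) * l0 powr (2 * \<beta> - 2 * min (2 * real J + 4) \<beta>))
        + 1 / a r powr (2 * min 1 \<beta>) + a r ^ CARD('d) / a r powr (2 * min 1 \<beta>)"
      have k: "0 \<le> ?k" using ar by auto
      show "ennreal (1 / (a r * lam n) powr (2 * \<beta>)
        + 1 / ((a r * lam n) powr (2 * min 1 \<beta>) * real (B n))
        + 1 / (a r * lam n) powr (2 * min 1 \<beta>) * ((a r * lam n) ^ CARD('d) / real n)) \<le> ennreal ?k * ?rate n"
        unfolding ennreal_mult'[OF k, symmetric] using n pos[OF n] l0(1) l0(2)[OF n] ar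
        by (intro ennreal_leI bias_rate_rescale) auto
    qed
    finally show ?thesis .
  qed

  have R_le: "(\<lambda>n. ennreal ((R n)\<^sup>2)) \<lesssim> ?rate"
  proof (rule lesssim_mono)
    fix n :: nat assume n: "1 \<le> n"
    let ?k = "(\<Sum>s = J + 2..m. \<bar>c s * (\<Sum>r\<le>J. \<omega> r / a r ^ (2 * s))\<bar> / l0 ^ (2 * (s - (J + 2))))\<^sup>2"
    have "(R n)\<^sup>2 \<le> ?k * (1 / lam n powr (2 * min (2 * real J + 4) \<beta>))"
      unfolding R_def by (rule higher_order_bias_bound[OF l0(1) l0(2)[OF n] \<beta>0 m_def])
    then have "ennreal ((R n)\<^sup>2) \<le> ennreal ?k * ennreal (1 / lam n powr (2 * min (2 * real J + 4) \<beta>))"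
      by (subst ennreal_mult'[symmetric]) (auto intro!: ennreal_leI)
    also have "\<dots> \<le> ennreal ?k * ?rate n"
      using pos[OF n] by (intro mult_left_mono ennreal_leI) auto
    finally show "ennreal ((R n)\<^sup>2) \<le> ennreal ?k * ?rate n" .
  qed

  have decomposition: "(\<integral>\<^sup>+ z. ennreal ((cond_mean_XT n P ({..<B n} \<times> {..J}) (\<lambda>(b, r). mondrian (a r * lam n))
          (\<lambda>D T. debiased_estimate n (B n) J \<omega> T D x) z - \<mu> x - I n)\<^sup>2) \<partial>SB n)
      \<le> (\<Sum>r\<le>J. ennreal (2 * (real J + 1) * (\<omega> r)\<^sup>2) * E r n) + ennreal 2 * ennreal ((R n)\<^sup>2)"
    (is "?lhs \<le> _") if n: "1 \<le> n" for n
  proof -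
    let ?h = "\<lambda>z. \<Sum>k\<in>{..<B n} \<times> {..J}. \<omega> (snd k) / real (B n) *
      tree_estimate n (snd z k) (\<lambda>i. regressed P (fst z i)) x"
    let ?f = "\<lambda>r z. (G n (\<pi> r n z) - \<mu> x - S r n)\<^sup>2"
    interpret SB: prob_space "SB n"
      unfolding SB_def by (intro prob_space_sample_space P) (auto simp: prob_space_mondrian)
    have AE: "AE z in SB n. cond_mean_XT n P ({..<B n} \<times> {..J}) (\<lambda>(b, r). mondrian (a r * lam n))
          (\<lambda>D T. debiased_estimate n (B n) J \<omega> T D x) z = ?h z"
      unfolding SB_def debiased_estimate_eq_sum
      by (rule cond_mean_tree_estimates(1)[OF P sets_P int_Y _ _ x order_refl])
        (auto simp: prob_space_mondrian sets_mondrian)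
    \<comment> \<open>Extracting forest \<open>r\<close> is measurable and has the law of an
      ordinary forest of lifetime \<open>a r * lam n\<close>, so each mean squared error can be
      computed on either space.\<close>
    have \<pi>: "\<pi> r n \<in> SB n \<rightarrow>\<^sub>M SS r n" "distr (SB n) (SS r n) (\<pi> r n) = SS r n" if "r \<le> J" for r
      using measurable_reindex_trees[of "\<lambda>b. (b, r)" "{..<B n}" "{..<B n} \<times> {..J}" n P "\<lambda>(b, r). mondrian (a r * lam n)"]
        distr_sample_space_reindex[of P "{..<B n} \<times> {..J}" "\<lambda>(b, r). mondrian (a r * lam n)" "\<lambda>b. (b, r)" "{..<B n}" n] that P
      by (auto simp: SB_def SS_def \<pi>_def prob_space_mondrian inj_on_def)
    have G_meas: "G n \<in> borel_measurable (SS r n)" for r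
      unfolding SS_def G_def
      by (rule cond_mean_tree_estimates(2)[OF P sets_P int_Y prob_space_mondrian sets_mondrian x order_refl])
    have f_meas: "?f r \<in> borel_measurable (SB n)" if "r \<le> J" for r
      using measurable_compose[OF \<pi>(1)[OF that] G_meas] by measurable
    have E_eq: "(\<integral>\<^sup>+ z. ennreal (?f r z) \<partial>SB n) = E r n" if "r \<le> J" for r
    proof -
      have "E r n = (\<integral>\<^sup>+ z. ennreal ((G n z - \<mu> x - S r n)\<^sup>2) \<partial>distr (SB n) (SS r n) (\<pi> r n))"
        by (simp add: E_def \<pi>(2)[OF that])
      also have "\<dots> = (\<integral>\<^sup>+ z. ennreal (?f r z) \<partial>SB n)"
        using G_meas[of r] by (subst nn_integral_distr[OF \<pi>(1)[OF that]]) auto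
      finally show ?thesis by simp
    qed
    \<comment> \<open>The factor \<open>2\<close> comes from separating \<open>R n\<close> in the
      square of a sum, the factor \<open>real J + 1\<close> from Cauchy-Schwarz over the
      \<open>J + 1\<close> forests.\<close>
    have pointwise: "(?h z - \<mu> x - I n)\<^sup>2 \<le> (\<Sum>r\<le>J. 2 * (real J + 1) * (\<omega> r)\<^sup>2 * ?f r z) + 2 * (R n)\<^sup>2" for z
    proof -
      have h: "?h z = (\<Sum>r\<le>J. \<omega> r * G n (\<pi> r n z))"
      proof -
        have "?h z = (\<Sum>b<B n. \<Sum>r\<le>J. \<omega> r / real (B n) * tree_estimate n (snd z (b, r)) (\<lambda>i. regressed P (fst z i)) x)"
          by (simp add: sum.cartesian_product case_prod_beta)
        also have "\<dots> = (\<Sum>r\<le>J. \<omega> r * G n (\<pi> r n z))"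
          unfolding G_def \<pi>_def sum_distrib_left by (subst sum.swap) (simp add: case_prod_beta)
        finally show ?thesis .
      qed
      have "(\<Sum>r\<le>J. \<omega> r * S r n) = I n + R n"
        unfolding S_def I_def R_def
        by (rule debiasing_weights_sum_bias[OF weights omega_bar \<beta>0 m_def])
      moreover have "(\<Sum>r\<le>J. \<omega> r * \<mu> x) = \<mu> x"
        using weights by (simp add: debiasing_weights_def flip: sum_distrib_right)
      \<comment> \<open>As the weights sum to one, the centring by \<open>\<mu> x\<close>
        distributes over the forests, and the error is the weighted sum of the individual errors
        plus \<open>R n\<close>.\<close>
      ultimately have "?h z - \<mu> x - I n = (\<Sum>r\<le>J. \<omega> r * (G n (\<pi> r n z) - \<mu> x - S r n)) + R n"
        unfolding h by (simp add: right_diff_distrib sum_subtractf)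
      then have "(?h z - \<mu> x - I n)\<^sup>2 \<le> 2 * (\<Sum>r\<le>J. \<omega> r * (G n (\<pi> r n z) - \<mu> x - S r n))\<^sup>2 + 2 * (R n)\<^sup>2"
        using sum_squares_bound[of "\<Sum>r\<le>J. \<omega> r * (G n (\<pi> r n z) - \<mu> x - S r n)" "R n"]
        by (simp add: power2_sum)
      also have "\<dots> \<le> 2 * ((\<Sum>r\<le>J. (\<omega> r * (G n (\<pi> r n z) - \<mu> x - S r n))\<^sup>2) * real (card {..J})) + 2 * (R n)\<^sup>2"
        by (intro add_right_mono mult_left_mono sum_squared_le_sum_of_squares) auto
      also have "\<dots> = (\<Sum>r\<le>J. 2 * (real J + 1) * (\<omega> r)\<^sup>2 * ?f r z) + 2 * (R n)\<^sup>2"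
        unfolding sum_distrib_left sum_distrib_right power_mult_distrib by (simp add: algebra_simps)
      finally show ?thesis .
    qed
    have "?lhs = (\<integral>\<^sup>+ z. ennreal ((?h z - \<mu> x - I n)\<^sup>2) \<partial>SB n)"
      using AE by (intro nn_integral_cong_AE) auto
    also have "\<dots> \<le> (\<integral>\<^sup>+ z. (\<Sum>r\<le>J. ennreal (2 * (real J + 1) * (\<omega> r)\<^sup>2) * ennreal (?f r z)) + ennreal 2 * ennreal ((R n)\<^sup>2) \<partial>SB n)"
    proof (rule nn_integral_mono)
      fix z
      have "ennreal ((?h z - \<mu> x - I n)\<^sup>2) \<le> ennreal ((\<Sum>r\<le>J. 2 * (real J + 1) * (\<omega> r)\<^sup>2 * ?f r z) + 2 * (R n)\<^sup>2)"
        by (rule ennreal_leI[OF pointwise])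
      also have "\<dots> = (\<Sum>r\<le>J. ennreal (2 * (real J + 1) * (\<omega> r)\<^sup>2) * ennreal (?f r z)) + ennreal 2 * ennreal ((R n)\<^sup>2)"
        by (subst ennreal_plus)
          (auto simp: sum_nonneg simp del: ennreal_numeral simp flip: ennreal_mult intro!: sum_ennreal[symmetric])
      finally show "ennreal ((?h z - \<mu> x - I n)\<^sup>2) \<le> \<dots>" .
    qed
    also have "\<dots> = (\<Sum>r\<le>J. ennreal (2 * (real J + 1) * (\<omega> r)\<^sup>2) * E r n) + ennreal 2 * ennreal ((R n)\<^sup>2)"
    proof -
      have "(\<integral>\<^sup>+ z. (\<Sum>r\<le>J. ennreal (2 * (real J + 1) * (\<omega> r)\<^sup>2) * ennreal (?f r z)) \<partial>SB n)
          = (\<Sum>r\<le>J. ennreal (2 * (real J + 1) * (\<omega> r)\<^sup>2) * E r n)"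
        using f_meas by (subst nn_integral_sum) (auto simp: nn_integral_cmult E_eq intro!: sum.cong)
      then show ?thesis
        using f_meas by (subst nn_integral_add) (auto simp: SB.emeasure_space_1)
    qed
    finally show ?thesis .
  qed

  have "(\<lambda>n. (\<Sum>r\<le>J. ennreal (2 * (real J + 1) * (\<omega> r)\<^sup>2) * E r n) + ennreal 2 * ennreal ((R n)\<^sup>2)) \<lesssim> ?rate"
    using E_le by (intro lesssim_add lesssim_sum lesssim_cmult R_le) auto
  from lesssim_trans[OF lesssim_mono[where C = 1] this] decomposition
  show ?thesis by (simp add: I_def SB_def)
qed

end
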